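(* Let $T\subset L$ be a theory with $PA\subseteq T\subseteq Th(N)$. For every model $M\models T$ and every while-program $S\in WP$, $AX(T)_M(S)=A_S^M$, i.e. the axiomatic semantics of $S$ in $M$ coincides with its X-semantics.
   Context: **Language.** $L$ is the (set of formulas of the) first-order language with equality and signature $\{+,\cdot,<,0,1\}$ of Peano arithmetic $PA$; $N$ is the standard model and $Th(N)$ the set of formulas of $L$ true in $N$. $M$ denotes both a model and its domain. All models considered are countable. An assignment over $M$ maps all variables to elements of $M$; $v(\vec a/\vec x)$ is the assignment equal to $v$ except that $\vec x$ is mapped to $\vec a$; $E^{M,v}$ is the value of the term $E$ at $v$. Operations and relations on vectors are componentwise. **Coding functions (definable in $PA$).** $\langle x,y\rangle=\lfloor (x+y+1)(x+y)/2\rfloor+y$, and $L(z),R(z)$ are its inverses: $L(\langle x,y\rangle)=x$, $R(\langle x,y\rangle)=y$, $\langle L(z),R(z)\rangle=z$. Put $\langle x_1,\dots,x_n\rangle=\langle x_1,\langle x_2,\dots,x_n\rangle\rangle$, and let $\overline z$ be the $n$-tuple coded by $z$ ($\overline z=z$ if $n=1$). The extended $\beta$-function $(x)_i$ is the remainder of $L(x)$ on division by $R(x)\cdot(i+1)+1$. **While-programs.** Expressions $E::=0\mid1\mid x\mid E_1+E_2\mid E_1\cdot E_2$; boolean expressions $B::=E_1<E_2\mid\neg B_1\mid B_1\to B_2$; programs $S::=x:=E\mid S_1;S_2\mid if\ B\ then\ S_1\ else\ S_2\ fi\mid while\ B\ do\ S_0\ od$. $WP$ is the set of all programs. $\vec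 x=(x_1,\dots,x_n)$ lists the program variables of $S$ (the formulas for subprograms of $S$ use the same vector $\vec x$). **Formulas.** For $\vec y=(y_1,\dots,y_n)$ disjoint from $\vec x$ define $\alpha_S(\vec x,\vec y)\in L$ by: for $x_i:=E$, $y_i=E(\vec x)\wedge\bigwedge_{j\ne i}y_j=x_j$; for $S_1;S_2$, $\exists\vec z(\alpha_{S_1}(\vec x,\vec z)\wedge\alpha_{S_2}(\vec z,\vec y))$; for the conditional, $(B(\vec x)\wedge\alpha_{S_1}(\vec x,\vec y))\vee(\neg B(\vec x)\wedge\alpha_{S_2}(\vec x,\vec y))$; for $S\equiv while\ B\ do\ S_0\ od$, $\exists i\,\alpha^*_S(i,\vec x,\vec y)\wedge\neg B(\vec y)$, where $\alpha_S^*(i,\vec x,\vec y)::=\exists w\big(\vec x=\overline{(w)_0}\wedge\forall j<i\,(B(\overline{(w)_j})\wedge\alpha_{S_0}(\overline{(w)_j},\overline{(w)_{j+1}}))\wedge\vec y=\overline{(w)_i}\big)$. Also $\varphi_{S_0}(\vec x,y,\vec z)::=\exists w\big(\overline{(w)_0}=\vec x\wedge\forall j<y\ \alpha_{S_0}(\overline{(w)_j},\overline{(w)_{j+1}})\wedge\overline{(w)_y}=\vec z\big)$. **X-semantics.** For $M\models PA$, the binary relation $A_S^M$ on assignments over $M$ is defined by: $(v,v')\in A^M_{x_i:=E}$ iff $v'=v(E^{M,v}/x_i)$; $A^M_{S_1;S_2}$ is the relational composition ($A_{S_1}^M$ first, then $A_{S_2}^M$); $(v,v')\in A^M_{if\,B\,then\,S_1\,else\,S_2\,fi}$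 iff ($M,v\models B$ and $(v,v')\in A_{S_1}^M$) or ($M,v\not\models B$ and $(v,v')\in A_{S_2}^M$); and $(v,v')\in A^M_{while\,B\,do\,S_0\,od}$ iff there are $i\in M$ and $\vec x_0,\dots,\vec x_i\in M$ (indexed by all $j\le i$ in $M$) such that $M\models\varphi_{S_0}(v(\vec x),j,\vec x_j)$ for all $j\le i$, $v(\vec x)=\vec x_0$, for all $j<i$: $M,v(\vec x_j/\vec x)\models B$ and $(v(\vec x_j/\vec x),v(\vec x_{j+1}/\vec x))\in A_{S_0}^M$, and $v'=v(\vec x_i/\vec x)$, $M,v'\not\models B$. **Hoare logic $HL(T)$.** $HL(T)\vdash\{p\}S\{q\}$ ($p,q\in L$) denotes provability from: the assignment axioms $\{p(E/x)\}x:=E\{p\}$; composition: from $\{p\}S_1\{r\}$ and $\{r\}S_2\{q\}$ infer $\{p\}S_1;S_2\{q\}$; conditional: from $\{p\wedge B\}S_1\{q\}$ and $\{p\wedge\neg B\}S_2\{q\}$ infer $\{p\}if\ B\ then\ S_1\ else\ S_2\ fi\{q\}$; iteration: from $\{r\wedge B\}S_0\{r\}$ infer $\{r\}while\ B\ do\ S_0\ od\{r\wedge\neg B\}$; consequence: from $p\to p_1$, $\{p_1\}S\{q_1\}$, $q_1\to q$ infer $\{p\}S\{q\}$; and all theorems of $T$ as axioms. **Axiomatic semantics.** For $M\models T$, $V$ the set of assignments over $M$, and $S\in WP$ with program variables $\vec x$, $AX(T)_M(S)$ is the set of pairs $(\sigma,\tau)\in V\times V$ such that $\sigma(y)=\tau(y)$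 for every variable $y$ not in $\vec x$, and for all $p,q\in L$ and $v\in V$: if $HL(T)\vdash\{p\}S\{q\}$ and $M,v(\sigma(\vec x)/\vec x)\models p$, then $M,v(\tau(\vec x)/\vec x)\models q$. *)

theory Defs
  imports Main "HOL-Library.Countable_Set"
begin

section \<open>The language of Peano arithmetic\<close>

datatype trm = Var nat | Zero | One | Plus trm trm | Times trm trm

datatype fm = Eq trm trm | Less trm trm | Neg fm | Imp fm fm | All nat fm

abbreviation And :: "fm \<Rightarrow> fm \<Rightarrow> fm" where
  "And p q \<equiv> Neg (Imp p (Neg q))"

abbreviation Or :: "fm \<Rightarrow> fm \<Rightarrow> fm" where
  "Or p q \<equiv> Imp (Neg p) q"

abbreviation Exists :: "nat \<Rightarrow> fm \<Rightarrow> fm" where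
  "Exists x p \<equiv> Neg (All x (Neg p))"

definition Exs :: "nat list \<Rightarrow> fm \<Rightarrow> fm" where
  "Exs xs p = foldr Exists xs p"

primrec tvars :: "trm \<Rightarrow> nat set" where
  "tvars (Var x) = {x}"
| "tvars Zero = {}"
| "tvars One = {}"
| "tvars (Plus s t) = tvars s \<union> tvars t"
| "tvars (Times s t) = tvars s \<union> tvars t"

primrec fvars :: "fm \<Rightarrow> nat set" where
  "fvars (Eq s t) = tvars s \<union> tvars t"
| "fvars (Less s t) = tvars s \<union> tvars t"
| "fvars (Neg p) = fvars p"
| "fvars (Imp p q) = fvars p \<union> fvars q"
| "fvars (All x p) = fvars p - {x}"

definition new_var :: "nat set \<Rightarrow> nat" where
  "new_var V = Suc (Max (insert 0 V))"

definition new_vars :: "nat \<Rightarrow> nat set \<Rightarrow> nat list" where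
  "new_vars n V = [new_var V ..< new_var V + n]"

text \<open>The update \<open>upd v xs as\<close> is written \<open>v(as/xs)\<close> on paper; it is
  used both for assignments and for substitutions (assignments of terms).\<close>

definition upd :: "(nat \<Rightarrow> 'a) \<Rightarrow> nat list \<Rightarrow> 'a list \<Rightarrow> nat \<Rightarrow> 'a" where
  "upd v xs as = (\<lambda>x. case map_of (zip xs as) x of Some a \<Rightarrow> a | None \<Rightarrow> v x)"

primrec tsubst :: "trm \<Rightarrow> (nat \<Rightarrow> trm) \<Rightarrow> trm" where
  "tsubst (Var x) s = s x"
| "tsubst Zero s = Zero"
| "tsubst One s = One"
| "tsubst (Plus t u) s = Plus (tsubst t s) (tsubst u s)"
| "tsubst (Times t u) s = Times (tsubst t s) (tsubst u s)"

text \<open>Simultaneous capture-avoiding substitution; a bound variable is renamed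
  only if it would otherwise capture a variable.\<close>

primrec subst :: "fm \<Rightarrow> (nat \<Rightarrow> trm) \<Rightarrow> fm" where
  "subst (Eq t u) s = Eq (tsubst t s) (tsubst u s)"
| "subst (Less t u) s = Less (tsubst t s) (tsubst u s)"
| "subst (Neg p) s = Neg (subst p s)"
| "subst (Imp p q) s = Imp (subst p s) (subst q s)"
| "subst (All x p) s =
     (let V = (\<Union>y \<in> fvars p - {x}. tvars (s y));
          z = (if x \<in> V then new_var V else x)
      in All z (subst p (s(x := Var z))))"

definition subst1 :: "fm \<Rightarrow> nat \<Rightarrow> trm \<Rightarrow> fm" where
  "subst1 p x t = subst p (Var(x := t))"


section \<open>Structures and satisfaction\<close>

text \<open>The domain of a structure is the whole type \<open>'a\<close>; equality is interpreted as
  identity.\<close>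

record 'a interp =
  izero :: 'a
  ione :: 'a
  iplus :: "'a \<Rightarrow> 'a \<Rightarrow> 'a"
  itimes :: "'a \<Rightarrow> 'a \<Rightarrow> 'a"
  iless :: "'a \<Rightarrow> 'a \<Rightarrow> bool"

primrec val :: "'a interp \<Rightarrow> (nat \<Rightarrow> 'a) \<Rightarrow> trm \<Rightarrow> 'a" where
  "val M v (Var x) = v x"
| "val M v Zero = izero M"
| "val M v One = ione M"
| "val M v (Plus s t) = iplus M (val M v s) (val M v t)"
| "val M v (Times s t) = itimes M (val M v s) (val M v t)"

primrec sat :: "'a interp \<Rightarrow> (nat \<Rightarrow> 'a) \<Rightarrow> fm \<Rightarrow> bool" where
  "sat M v (Eq s t) \<longleftrightarrow> val M v s = val M v t"
| "sat M v (Less s t) \<longleftrightarrow> iless M (val M v s) (val M v t)"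
| "sat M v (Neg p) \<longleftrightarrow> \<not> sat M v p"
| "sat M v (Imp p q) \<longleftrightarrow> (sat M v p \<longrightarrow> sat M v q)"
| "sat M v (All x p) \<longleftrightarrow> (\<forall>a. sat M (v(x := a)) p)"

definition is_model :: "'a interp \<Rightarrow> fm set \<Rightarrow> bool" where
  "is_model M T \<longleftrightarrow> (\<forall>p\<in>T. \<forall>v. sat M v p)"

definition std_N :: "nat interp" where
  "std_N = \<lparr>izero = 0, ione = 1, iplus = (+), itimes = (*), iless = (<)\<rparr>"

definition Th_N :: "fm set" where
  "Th_N = {p. \<forall>v. sat std_N v p}"


section \<open>Provability and Peano arithmetic\<close>

text \<open>A Hilbert calculus for first-order logic with equality. Formulas in \<open>T\<close> may
  be open; because of the generalisation rule they are read as universally closed, which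
  agrees with \<^const>\<open>is_model\<close>.\<close>

inductive provable :: "fm set \<Rightarrow> fm \<Rightarrow> bool" for T where
  Axiom: "p \<in> T \<Longrightarrow> provable T p"
| P1: "provable T (Imp p (Imp q p))"
| P2: "provable T (Imp (Imp p (Imp q r)) (Imp (Imp p q) (Imp p r)))"
| P3: "provable T (Imp (Imp (Neg p) (Neg q)) (Imp q p))"
| Inst: "provable T (Imp (All x p) (subst1 p x t))"
| Distr: "x \<notin> fvars p \<Longrightarrow> provable T (Imp (All x (Imp p q)) (Imp p (All x q)))"
| Refl: "provable T (Eq t t)"
| Eq_cong: "provable T (Imp (Eq s s') (Imp (Eq t t') (Imp (Eq s t) (Eq s' t'))))"
| Less_cong: "provable T (Imp (Eq s s') (Imp (Eq t t') (Imp (Less s t) (Less s' t'))))"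
| Plus_cong: "provable T (Imp (Eq s s') (Imp (Eq t t') (Eq (Plus s t) (Plus s' t'))))"
| Times_cong: "provable T (Imp (Eq s s') (Imp (Eq t t') (Eq (Times s t) (Times s' t'))))"
| MP: "provable T (Imp p q) \<Longrightarrow> provable T p \<Longrightarrow> provable T q"
| Gen: "provable T p \<Longrightarrow> provable T (All x p)"

inductive_set PA :: "fm set" where
  Succ_neq_0: "Neg (Eq (Plus (Var 0) One) Zero) \<in> PA"
| Succ_inject: "Imp (Eq (Plus (Var 0) One) (Plus (Var 1) One)) (Eq (Var 0) (Var 1)) \<in> PA"
| Plus_0: "Eq (Plus (Var 0) Zero) (Var 0) \<in> PA"
| Plus_Succ: "Eq (Plus (Var 0) (Plus (Var 1) One)) (Plus (Plus (Var 0) (Var 1)) One) \<in> PA"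
| Times_0: "Eq (Times (Var 0) Zero) Zero \<in> PA"
| Times_Succ: "Eq (Times (Var 0) (Plus (Var 1) One)) (Plus (Times (Var 0) (Var 1)) (Var 0)) \<in> PA"
| Not_less_0: "Neg (Less (Var 0) Zero) \<in> PA"
| Less_SuccD: "Imp (Less (Var 0) (Plus (Var 1) One)) (Or (Less (Var 0) (Var 1)) (Eq (Var 0) (Var 1))) \<in> PA"
| Less_SuccI: "Imp (Or (Less (Var 0) (Var 1)) (Eq (Var 0) (Var 1))) (Less (Var 0) (Plus (Var 1) One)) \<in> PA"
| Induction: "Imp (And (subst1 p x Zero) (All x (Imp p (subst1 p x (Plus (Var x) One))))) (All x p) \<in> PA"


section \<open>Coding functions\<close>

text \<open>Each function is given by a formula defining its graph; terms that contain
  coding functions are eliminated from formulas by means of these graphs.\<close>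

text \<open>\<open>z = \<langle>x, y\<rangle>\<close>, where \<open>u\<close> is the floor of half of
  \<open>(x + y + 1)(x + y)\<close>.\<close>

definition pair_fm :: "trm \<Rightarrow> trm \<Rightarrow> trm \<Rightarrow> fm" where
  "pair_fm x y z =
     (let u = new_var (tvars x \<union> tvars y \<union> tvars z);
          d = Plus (Var u) (Var u);
          e = Times (Plus (Plus x y) One) (Plus x y)
      in Exists u (And (Or (Eq d e) (Eq (Plus d One) e)) (Eq z (Plus (Var u) y))))"

text \<open>\<open>us\<close> is the tuple coded by \<open>z\<close>. The tuples in question
  are never empty; the first equation only makes the function total.\<close>

fun tuple_fm :: "trm \<Rightarrow> nat list \<Rightarrow> fm" where
  "tuple_fm z [] = Eq Zero Zero"
| "tuple_fm z [u] = Eq z (Var u)"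
| "tuple_fm z (u # us) =
     (let t = new_var (tvars z \<union> set (u # us))
      in Exists t (And (pair_fm (Var u) (Var t) z) (tuple_fm (Var t) us)))"

text \<open>\<open>r = (x)\<^sub>i\<close>, i.e. \<open>r\<close> is the remainder of \<open>a\<close> on
  division by \<open>b (i + 1) + 1\<close>, where \<open>a = L(x)\<close> and \<open>b = R(x)\<close>.\<close>

definition beta_fm :: "trm \<Rightarrow> trm \<Rightarrow> trm \<Rightarrow> fm" where
  "beta_fm x i r =
     (let a = new_var (tvars x \<union> tvars i \<union> tvars r); b = Suc a; q = Suc b;
          m = Plus (Times (Var b) (Plus i One)) One
      in Exs [a, b, q]
           (And (pair_fm (Var a) (Var b) x)
             (And (Eq (Var a) (Plus (Times (Var q) m) r)) (Less r m))))"

text \<open>\<open>us\<close> is the tuple coded by \<open>(w)\<^sub>i\<close>.\<close>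

definition entry_fm :: "trm \<Rightarrow> trm \<Rightarrow> nat list \<Rightarrow> fm" where
  "entry_fm w i us =
     (let c = new_var (tvars w \<union> tvars i \<union> set us)
      in Exists c (And (beta_fm w i (Var c)) (tuple_fm (Var c) us)))"

text \<open>Some \<open>w\<close> codes a sequence of tuples of length \<open>i + 1\<close> that starts with
  \<open>ys\<close>, ends with \<open>zs\<close>, and whose consecutive entries are related by
  \<open>step\<close>.\<close>

definition seq_fm :: "(nat list \<Rightarrow> nat list \<Rightarrow> fm) \<Rightarrow> nat \<Rightarrow> nat list \<Rightarrow> nat list \<Rightarrow> fm" where
  "seq_fm step i ys zs =
     (let V = insert i (set ys \<union> set zs);
          n = length ys;
          w = new_var V;
          j = Suc w;
          ps = new_vars n (insert j V);
          qs = new_vars n (insert j V \<union> set ps)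
      in Exists w
           (And (entry_fm (Var w) Zero ys)
             (And (All j (Imp (Less (Var j) (Var i))
                     (Exs (ps @ qs)
                       (And (entry_fm (Var w) (Var j) ps)
                         (And (entry_fm (Var w) (Plus (Var j) One) qs) (step ps qs))))))
               (entry_fm (Var w) (Var i) zs))))"


section \<open>While-programs\<close>

text \<open>Program expressions are exactly the terms of the language.\<close>

datatype bexp = BLess trm trm | BNot bexp | BImp bexp bexp

datatype prog =
    Assign nat trm
  | Seq prog prog
  | Cond bexp prog prog
  | While bexp prog

primrec bfm :: "bexp \<Rightarrow> fm" where
  "bfm (BLess s t) = Less s t"
| "bfm (BNot b) = Neg (bfm b)"
| "bfm (BImp b c) = Imp (bfm b) (bfm c)"

primrec pvars :: "prog \<Rightarrow> nat set" where
  "pvars (Assign x e) = insert x (tvars e)"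
| "pvars (Seq S1 S2) = pvars S1 \<union> pvars S2"
| "pvars (Cond b S1 S2) = fvars (bfm b) \<union> pvars S1 \<union> pvars S2"
| "pvars (While b S) = fvars (bfm b) \<union> pvars S"

text \<open>The list \<open>xs\<close> is the vector of program variables of the whole program,
  which is kept fixed for all subprograms. In \<open>alpha_fm xs S ys zs\<close>, which is
  \<open>\<alpha>\<^sub>S(ys, zs)\<close>, the program variables are replaced by the variables
  \<open>ys\<close> (input) and \<open>zs\<close> (output), so that instances such as
  \<open>\<alpha>\<^sub>S(xs, zs)\<close> are available without substituting into quantified
  formulas.\<close>

definition at_vars :: "nat list \<Rightarrow> nat list \<Rightarrow> nat \<Rightarrow> trm" where
  "at_vars xs ys = upd Var xs (map Var ys)"

primrec alpha_fm :: "nat list \<Rightarrow> prog \<Rightarrow> nat list \<Rightarrow> nat list \<Rightarrow> fm" where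
  "alpha_fm xs (Assign x e) ys zs =
     foldr And
       (map (\<lambda>(x', y, z).
          if x' = x then Eq (Var z) (tsubst e (at_vars xs ys)) else Eq (Var z) (Var y))
        (zip xs (zip ys zs)))
       (Eq Zero Zero)"
| "alpha_fm xs (Seq S1 S2) ys zs =
     (let us = new_vars (length xs) (set ys \<union> set zs)
      in Exs us (And (alpha_fm xs S1 ys us) (alpha_fm xs S2 us zs)))"
| "alpha_fm xs (Cond b S1 S2) ys zs =
     Or (And (subst (bfm b) (at_vars xs ys)) (alpha_fm xs S1 ys zs))
        (And (Neg (subst (bfm b) (at_vars xs ys))) (alpha_fm xs S2 ys zs))"
| "alpha_fm xs (While b S) ys zs =
     (let i = new_var (set ys \<union> set zs)
      in And (Exists i (seq_fm (\<lambda>ps qs. And (subst (bfm b) (at_vars xs ps)) (alpha_fm xs S ps qs))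
                      i ys zs))
             (Neg (subst (bfm b) (at_vars xs zs))))"

definition phi_fm :: "nat list \<Rightarrow> prog \<Rightarrow> nat list \<Rightarrow> nat \<Rightarrow> nat list \<Rightarrow> fm" where
  "phi_fm xs S ys i zs = seq_fm (alpha_fm xs S) i ys zs"


section \<open>X-semantics\<close>

text \<open>The run of a loop is indexed by the elements \<open>j \<le> i\<close> of the structure,
  which may be nonstandard; \<open>c j\<close> is the vector of values at stage \<open>j\<close>. In the
  condition on \<open>phi_fm\<close> the vector \<open>xs\<close> has the values given by \<open>v\<close>,
  and the fresh variables \<open>y\<close> and \<open>zs\<close> take the values \<open>j\<close> and
  \<open>c j\<close>.\<close>

primrec X_sem :: "'a interp \<Rightarrow> nat list \<Rightarrow> prog \<Rightarrow> ((nat \<Rightarrow> 'a) \<times> (nat \<Rightarrow> 'a)) set" where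
  "X_sem M xs (Assign x e) = {(v, v'). v' = v(x := val M v e)}"
| "X_sem M xs (Seq S1 S2) = X_sem M xs S1 O X_sem M xs S2"
| "X_sem M xs (Cond b S1 S2) =
     {(v, v'). (sat M v (bfm b) \<and> (v, v') \<in> X_sem M xs S1) \<or>
               (\<not> sat M v (bfm b) \<and> (v, v') \<in> X_sem M xs S2)}"
| "X_sem M xs (While b S) =
     (let y = new_var (set xs); zs = new_vars (length xs) (insert y (set xs))
      in {(v, v'). \<exists>i c.
            (\<forall>j. iless M j i \<or> j = i \<longrightarrow>
               length (c j) = length xs \<and>
               sat M (upd v (y # zs) (j # c j)) (phi_fm xs S xs y zs)) \<and>
            map v xs = c (izero M) \<and>
            (\<forall>j. iless M j i \<longrightarrow>
               sat M (upd v xs (c j)) (bfm b) \<and>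
               (upd v xs (c j), upd v xs (c (iplus M j (ione M)))) \<in> X_sem M xs S) \<and>
            v' = upd v xs (c i) \<and> \<not> sat M v' (bfm b)})"


section \<open>Hoare logic and axiomatic semantics\<close>

inductive HL :: "fm set \<Rightarrow> fm \<Rightarrow> prog \<Rightarrow> fm \<Rightarrow> bool" for T where
  Assign: "HL T (subst1 p x e) (Assign x e) p"
| Seq: "HL T p S1 r \<Longrightarrow> HL T r S2 q \<Longrightarrow> HL T p (Seq S1 S2) q"
| Cond: "HL T (And p (bfm b)) S1 q \<Longrightarrow> HL T (And p (Neg (bfm b))) S2 q \<Longrightarrow> HL T p (Cond b S1 S2) q"
| While: "HL T (And r (bfm b)) S r \<Longrightarrow> HL T r (While b S) (And r (Neg (bfm b)))"
| Conseq: "provable T (Imp p p1) \<Longrightarrow> HL T p1 S q1 \<Longrightarrow> provable T (Imp q1 q) \<Longrightarrow> HL T p S q"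

definition AX :: "fm set \<Rightarrow> 'a interp \<Rightarrow> nat list \<Rightarrow> prog \<Rightarrow> ((nat \<Rightarrow> 'a) \<times> (nat \<Rightarrow> 'a)) set" where
  "AX T M xs S =
     {(\<sigma>, \<tau>). (\<forall>y. y \<notin> set xs \<longrightarrow> \<sigma> y = \<tau> y) \<and>
        (\<forall>p q v. HL T p S q \<longrightarrow> sat M (upd v xs (map \<sigma> xs)) p \<longrightarrow>
           sat M (upd v xs (map \<tau> xs)) q)}"

end

(* In a model M of PA the X-semantics of S is the relation defined by alpha_S: the sequence of a
   while-loop is pinned down by phi, and codes of sequences of any length in M exist by the beta
   function lemma, proved inside M. Hoare triples are sound for this relation, since invariants are
   preserved along a coded sequence by induction in M; this gives one inclusion. Conversely, for fresh
   variables us the triple {xs = us} S {alpha_S(us, xs)} is derivable: all intermediate assertions are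
   expressible strongest postconditions, and the implications between them hold in every model of
   T (a superset of PA), so they are provable by Goedel's completeness theorem. Applied to this triple, the
   axiomatic semantics is contained in alpha_S. *)

theory Submission
  imports Defs "HOL-Library.Countable"
begin

text \<open>Two obstacles shape the proof. In a nonstandard model induction holds only for
  properties defined by a formula with parameters, so each induction inside \<open>M\<close> comes
  with an explicit formula. And the domain of a structure is a whole type: the countermodel in the
  completeness theorem has domain \<open>nat\<close>, which is possible because PA makes the term
  model infinite. Implications between assertions are therefore checked over \<open>nat\<close>
  only, while the final model may live on another type; the arithmetic is developed for both in the
  locale \<open>pa_model\<close>. In the X-semantics of a loop the stages are given by a function
  that need not be definable, and \<open>phi_fm\<close> offers a separate code for every stage, of a
  run that does not mention the test. These codes fit together because programs are deterministic:
  two coded runs with the same start agree as long as both last, which is an induction on the codes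
  alone.\<close>

section \<open>Fresh variables, coincidence and substitution\<close>

lemma finite_tvars [simp]: "finite (tvars t)"
  by (induction t) auto

lemma finite_fvars [simp]: "finite (fvars p)"
  by (induction p) auto

text \<open>The offset \<open>k\<close> serves the formulas that take several consecutive variables
  from one call of \<open>new_var\<close>.\<close>

lemma new_var_notin:
  assumes "finite V"
  shows "new_var V + k \<notin> V"
proof
  assume "new_var V + k \<in> V"
  then have "new_var V + k \<le> Max (insert 0 V)"
    using assms by (intro Max_ge) auto
  then show False by (simp add: new_var_def)
qed

lemma new_var_fresh: "finite V \<Longrightarrow> new_var V \<notin> V"
  using new_var_notin[of V 0] by simp

lemma length_new_vars [simp]: "length (new_vars n V) = n"
  by (simp add: new_vars_def)

lemma distinct_new_vars [simp]: "distinct (new_vars n V)"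
  by (simp add: new_vars_def)

lemma new_vars_fresh: "finite V \<Longrightarrow> set (new_vars n V) \<inter> V = {}"
proof -
  assume V: "finite V"
  have "x \<notin> V" if "x \<ge> new_var V" for x
    using new_var_notin[OF V, of "x - new_var V"] that by simp
  then show ?thesis by (auto simp: new_vars_def)
qed

lemma val_cong: "(\<And>x. x \<in> tvars t \<Longrightarrow> v x = v' x) \<Longrightarrow> val M v t = val M v' t"
  by (induction t) auto

lemma sat_cong: "(\<And>x. x \<in> fvars p \<Longrightarrow> v x = v' x) \<Longrightarrow> sat M v p = sat M v' p"
proof (induction p arbitrary: v v')
  case (Eq s t)
  then have "val M v s = val M v' s" "val M v t = val M v' t" by (auto intro!: val_cong)
  then show ?case by simp
next
  case (Less s t)
  then have "val M v s = val M v' s" "val M v t = val M v' t" by (auto intro!: val_cong)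
  then show ?case by simp
next
  case (Neg p)
  then have "sat M v p = sat M v' p" by (intro Neg.IH) auto
  then show ?case by simp
next
  case (Imp p q)
  have "sat M v p = sat M v' p" "sat M v q = sat M v' q"
    using Imp.prems by (auto intro!: Imp.IH)
  then show ?case by simp
next
  case (All x p)
  have "sat M (v(x := a)) p = sat M (v'(x := a)) p" for a
    using All.prems by (intro All.IH) auto
  then show ?case by simp
qed

lemma val_upd_fresh: "x \<notin> tvars t \<Longrightarrow> val M (v(x := a)) t = val M v t"
  by (rule val_cong) auto

lemma sat_upd_fresh: "x \<notin> fvars p \<Longrightarrow> sat M (v(x := a)) p = sat M v p"
  by (rule sat_cong) auto

lemma val_tsubst: "val M v (tsubst t s) = val M (\<lambda>x. val M v (s x)) t"
  by (induction t) auto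

text \<open>At a quantifier, the possibly renamed variable \<open>z\<close> lies outside
  \<open>V\<close>, the variables of the terms put in for the free variables; so resetting
  \<open>z\<close> leaves the values of these terms unchanged.\<close>

lemma sat_subst: "sat M v (subst p s) = sat M (\<lambda>x. val M v (s x)) p"
proof (induction p arbitrary: v s)
  case (All x p)
  define V where "V = (\<Union>y \<in> fvars p - {x}. tvars (s y))"
  define z where "z = (if x \<in> V then new_var V else x)"
  have "finite V" by (simp add: V_def)
  then have zV: "z \<notin> V" using new_var_fresh by (auto simp: z_def)
  have "sat M (v(z := a)) (subst p (s(x := Var z))) = sat M ((\<lambda>x. val M v (s x))(x := a)) p" for a
  proof -
    have "sat M (v(z := a)) (subst p (s(x := Var z)))
        = sat M (\<lambda>y. val M (v(z := a)) ((s(x := Var z)) y)) p" by (rule All.IH)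
    also have "\<dots> = sat M ((\<lambda>x. val M v (s x))(x := a)) p"
      using zV by (intro sat_cong) (auto simp: V_def val_upd_fresh)
    finally show ?thesis .
  qed
  then have "sat M v (All z (subst p (s(x := Var z)))) = sat M (\<lambda>x. val M v (s x)) (All x p)"
    by simp
  then show ?case by (simp only: subst.simps Let_def flip: V_def z_def)
qed (simp_all add: val_tsubst)

lemma sat_subst1: "sat M v (subst1 p x t) = sat M (v(x := val M v t)) p"
proof -
  have "(\<lambda>y. val M v ((Var(x := t)) y)) = v(x := val M v t)" by auto
  then show ?thesis by (simp add: subst1_def sat_subst)
qed


section \<open>Completeness of the Hilbert calculus\<close>

instance trm :: countable by countable_datatype
instance fm :: countable by countable_datatype

text \<open>Derivability from local hypotheses, which may not be generalised.\<close>

inductive ded :: "fm set \<Rightarrow> fm set \<Rightarrow> fm \<Rightarrow> bool" for T G where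
  Thm: "provable T p \<Longrightarrow> ded T G p"
| Hyp: "p \<in> G \<Longrightarrow> ded T G p"
| Mp: "ded T G (Imp p q) \<Longrightarrow> ded T G p \<Longrightarrow> ded T G q"

lemma ded_mono: "ded T G p \<Longrightarrow> G \<subseteq> G' \<Longrightarrow> ded T G' p"
  by (induction rule: ded.induct) (auto intro: ded.intros)

lemma ded_finite: "ded T G p \<Longrightarrow> \<exists>D. finite D \<and> D \<subseteq> G \<and> ded T D p"
proof (induction rule: ded.induct)
  case (Thm p)
  then show ?case by (intro exI[of _ "{}"]) (auto intro: ded.Thm)
next
  case (Hyp p)
  then show ?case by (intro exI[of _ "{p}"]) (auto intro: ded.Hyp)
next
  case (Mp p q)
  then obtain D1 D2 where "finite D1" "D1 \<subseteq> G" "ded T D1 (Imp p q)"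
    "finite D2" "D2 \<subseteq> G" "ded T D2 p" by blast
  then show ?case
    by (intro exI[of _ "D1 \<union> D2"]) (auto intro: ded.Mp ded_mono)
qed

lemma ded_empty: "ded T {} p \<Longrightarrow> provable T p"
  by (induction rule: ded.induct) (auto intro: provable.MP)

lemma ded_refl: "ded T G (Imp p p)"
  by (meson ded.Thm ded.Mp provable.P1 provable.P2)

text \<open>Generalisation occurs only inside \<open>Thm\<close>, on formulas proved without local
  hypotheses, so no case for it arises.\<close>

lemma deduction: "ded T (insert p G) q \<Longrightarrow> ded T G (Imp p q)"
proof (induction rule: ded.induct)
  case (Thm q)
  then show ?case by (meson ded.Thm ded.Mp provable.P1)
next
  case (Hyp q)
  then show ?case
    by (metis ded.Hyp ded.Mp ded.Thm ded_refl insertE provable.P1)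
next
  case (Mp r q)
  then show ?case by (meson ded.Thm ded.Mp provable.P2)
qed

lemma ded_explode: "ded T G p \<Longrightarrow> ded T G (Neg p) \<Longrightarrow> ded T G q"
  by (meson ded.Thm ded.Mp provable.P1 provable.P3)

text \<open>The contradiction is aimed at the negation of the theorem \<open>Imp p p\<close>; the
  contraposition axiom \<open>P3\<close> then returns \<open>p\<close>.\<close>

lemma ded_by_contra:
  assumes "ded T (insert (Neg p) G) q" and "ded T (insert (Neg p) G) (Neg q)"
  shows "ded T G p"
proof -
  have "ded T (insert (Neg p) G) (Neg (Imp p p))"
    using assms by (rule ded_explode)
  then have "ded T G (Imp (Neg p) (Neg (Imp p p)))" by (rule deduction)
  then show ?thesis by (meson ded.Thm ded.Mp provable.P3 ded_refl)
qed

lemma ded_NegI: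
  assumes "ded T (insert p G) q" and "ded T (insert p G) (Neg q)"
  shows "ded T G (Neg p)"
proof -
  let ?G = "insert (Neg (Neg p)) G"
  have p: "ded T ?G p"
    by (rule ded_by_contra[where q = "Neg p"]) (auto intro: ded.Hyp)
  have sub: "insert p G \<subseteq> insert p ?G" by auto
  have "ded T ?G (Imp p q)" "ded T ?G (Imp p (Neg q))"
    using assms sub by (auto intro: deduction ded_mono)
  then show ?thesis using p by (auto intro: ded_by_contra ded.Mp)
qed

text \<open>The finitely many hypotheses are discharged one at a time, and \<open>Distr\<close>
  moves the quantifier past each of them.\<close>

lemma ded_Gen:
  assumes "finite G" "ded T G p" "\<forall>q\<in>G. x \<notin> fvars q"
  shows "ded T G (All x p)"
  using assms
proof (induction G arbitrary: p rule: finite_induct)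
  case empty
  then show ?case by (metis ded_empty ded.Thm provable.Gen)
next
  case (insert q G)
  then have "ded T G (All x (Imp q p))" by (auto intro: deduction)
  then have "ded T G (Imp q (All x p))"
    using insert.prems by (meson ded.Mp ded.Thm provable.Distr insertI1)
  then show ?case by (meson ded.Hyp ded.Mp ded_mono insertI1 subset_insertI)
qed

section \<open>Renaming to variables that occur neither free nor bound\<close>

primrec bvars :: "fm \<Rightarrow> nat set" where
  "bvars (Eq s t) = {}"
| "bvars (Less s t) = {}"
| "bvars (Neg p) = bvars p"
| "bvars (Imp p q) = bvars p \<union> bvars q"
| "bvars (All x p) = insert x (bvars p)"

lemma finite_bvars [simp]: "finite (bvars p)"
  by (induction p) auto

lemma tsubst_cong: "(\<And>x. x \<in> tvars t \<Longrightarrow> s x = s' x) \<Longrightarrow> tsubst t s = tsubst t s'"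
  by (induction t) auto

lemma subst_cong: "(\<And>x. x \<in> fvars p \<Longrightarrow> s x = s' x) \<Longrightarrow> subst p s = subst p s'"
proof (induction p arbitrary: s s')
  case (Eq t u)
  then show ?case by (auto intro!: tsubst_cong)
next
  case (Less t u)
  then show ?case by (auto intro!: tsubst_cong)
next
  case (Neg p)
  then show ?case by (metis fvars.simps(3) subst.simps(3))
next
  case (Imp p q)
  then show ?case by (metis UnCI fvars.simps(4) subst.simps(4))
next
  case (All x p)
  have V: "(\<Union>y \<in> fvars p - {x}. tvars (s y)) = (\<Union>y \<in> fvars p - {x}. tvars (s' y))"
    using All.prems by auto
  have "subst p (s(x := t)) = subst p (s'(x := t))" for t
    using All.prems by (intro All.IH) auto
  then show ?case by (simp add: V Let_def)
qed

lemma tsubst_Var [simp]: "tsubst t Var = t"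
  by (induction t) auto

lemma subst_Var [simp]: "subst p Var = p"
  by (induction p) (auto simp: Let_def)

lemma subst_unchanged: "(\<And>x. x \<in> fvars p \<Longrightarrow> s x = Var x) \<Longrightarrow> subst p s = p"
  using subst_cong[of p s Var] by simp

lemma subst_All:
  assumes "\<And>y. y \<in> fvars p - {x} \<Longrightarrow> x \<notin> tvars (s y)"
  shows "subst (All x p) s = All x (subst p (s(x := Var x)))"
  using assms by (auto simp: Let_def)

lemma tsubst_rename_back:
  "z \<notin> tvars t \<Longrightarrow> tsubst (tsubst t (Var(x := Var z))) (Var(z := Var x)) = t"
  by (induction t) auto

lemma subst_rename_All:
  assumes "y \<noteq> z"
  shows "subst (All y p) (Var(x := Var z)) = All y (if y = x then p else subst p (Var(x := Var z)))"
proof -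
  have "subst (All y p) (Var(x := Var z)) = All y (subst p (Var(x := Var z, y := Var y)))"
    using assms by (intro subst_All) (auto split: if_splits)
  moreover have "Var(x := Var z, y := Var y) = (if y = x then Var else Var(x := Var z))" by auto
  ultimately show ?thesis by simp
qed

lemma tvars_rename: "w \<in> tvars (tsubst t (Var(x := Var z))) \<Longrightarrow> w \<in> tvars t - {x} \<or> w = z"
  by (induction t) (auto simp: fun_upd_def split: if_splits)

lemma fvars_rename:
  "z \<notin> bvars p \<Longrightarrow> w \<in> fvars (subst p (Var(x := Var z))) \<Longrightarrow> w \<in> fvars p - {x} \<or> w = z"
proof (induction p)
  case (All y p)
  then have "y \<noteq> z" by simp
  with All.prems(2) have w: "w \<in> fvars (if y = x then p else subst p (Var(x := Var z))) - {y}"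
    by (simp only: subst_rename_All fvars.simps not_False_eq_True)
  show ?case
  proof (cases "y = x")
    case True
    then show ?thesis using w by (simp only: if_True) auto
  next
    case False
    then have "w \<in> fvars p - {x} \<or> w = z"
      using w All.prems(1) by (intro All.IH) (simp_all only: if_False bvars.simps, blast+)
    then show ?thesis using w by auto
  qed
qed (use tvars_rename in \<open>fastforce+\<close>)

text \<open>As \<open>z\<close> is not bound in \<open>p\<close>, \<open>subst\<close> never renames
  a quantifier here. The result is an identity of formulas, not just an equivalence, so that the
  axiom \<open>Inst\<close> can lead from a generalisation over \<open>z\<close> back to
  \<open>p\<close> itself.\<close>

lemma subst_rename_back:
  "z \<notin> fvars p \<union> bvars p \<Longrightarrow> subst (subst p (Var(x := Var z))) (Var(z := Var x)) = p"
proof (induction p)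
  case (All y p)
  then have yz: "y \<noteq> z" by simp
  show ?case
  proof (cases "y = x")
    case True
    have "subst (All y p) (Var(z := Var x)) = All y p"
      using All.prems True by (intro subst_unchanged) auto
    then show ?thesis unfolding subst_rename_All[OF yz]
      using True by (simp only: if_True simp_thms)
  next
    case False
    have "subst (subst p (Var(x := Var z))) (Var(z := Var x)) = p"
      using All.prems yz by (intro All.IH) auto
    then show ?thesis
      by (simp only: subst_rename_All[OF yz] subst_rename_All[OF False] yz False if_False)
  qed
qed (auto simp: tsubst_rename_back)

section \<open>Consistent extensions with witnesses\<close>

definition consistent :: "fm set \<Rightarrow> fm set \<Rightarrow> bool" where
  "consistent T G \<longleftrightarrow> (\<exists>p. \<not> ded T G p)"

lemma ded_Neg_if_inconsistent:
  "\<not> consistent T (insert p G) \<Longrightarrow> ded T G (Neg p)"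
  by (meson consistent_def ded_NegI)

text \<open>Variables act as Henkin constants. If the instance at \<open>z\<close> could not be
  refuted consistently, \<open>G\<close> would derive it; since \<open>z\<close> is fresh it can be
  generalised, and renaming back yields \<open>All x p\<close>, which \<open>G\<close>
  refutes.\<close>

lemma consistent_witness:
  assumes "finite G" "consistent T G" "Neg (All x p) \<in> G"
    and z: "\<forall>q\<in>G. z \<notin> fvars q \<union> bvars q"
  shows "consistent T (insert (Neg (subst1 p x (Var z))) G)"
proof (rule ccontr)
  assume "\<not> consistent T (insert (Neg (subst1 p x (Var z))) G)"
  then have "ded T G (subst1 p x (Var z))"
    by (meson consistent_def ded_by_contra)
  then have "ded T G (All z (subst1 p x (Var z)))"
    using assms by (auto intro: ded_Gen)
  moreover have "ded T G (Imp (All z (subst1 p x (Var z))) (All x p))"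
  proof -
    let ?q = "All z (subst1 p x (Var z))"
    have pz: "z \<notin> fvars p" "z \<notin> bvars p" and zx: "z \<noteq> x"
      using z \<open>Neg (All x p) \<in> G\<close> by auto
    then have "subst1 (subst1 p x (Var z)) z (Var x) = p"
      using pz by (simp add: subst1_def subst_rename_back)
    then have "ded T {?q} p"
      by (metis ded.Hyp ded.Thm ded.Mp provable.Inst singletonI)
    moreover have "x \<notin> fvars ?q"
      using fvars_rename[OF pz(2)] zx by (auto simp: subst1_def)
    ultimately have "ded T {?q} (All x p)" by (auto intro: ded_Gen)
    then have "ded T {} (Imp ?q (All x p))" by (rule deduction)
    then show ?thesis by (rule ded_mono) simp
  qed
  ultimately have "ded T G (All x p)" by (rule ded.Mp[rotated])
  moreover have "ded T G (Neg (All x p))" using assms by (auto intro: ded.Hyp)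
  ultimately show False using assms ded_explode by (metis consistent_def)
qed


definition fresh_for :: "fm set \<Rightarrow> nat" where
  "fresh_for G = new_var (\<Union>q\<in>G. fvars q \<union> bvars q)"

lemma fresh_for: "finite G \<Longrightarrow> q \<in> G \<Longrightarrow> fresh_for G \<notin> fvars q \<union> bvars q"
  unfolding fresh_for_def using new_var_fresh[of "\<Union>q\<in>G. fvars q \<union> bvars q"] by auto

fun witness :: "fm set \<Rightarrow> fm \<Rightarrow> fm set" where
  "witness G (Neg (All x p)) = {Neg (subst1 p x (Var (fresh_for (insert (Neg (All x p)) G))))}"
| "witness G p = {}"

lemma finite_witness [simp]: "finite (witness G p)"
  by (induction G p rule: witness.induct) auto

lemma consistent_add_witness:
  "finite G \<Longrightarrow> consistent T (insert p G) \<Longrightarrow> consistent T (witness G p \<union> insert p G)"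
proof (induction G p rule: witness.induct)
  case (1 G x p)
  let ?G = "insert (Neg (All x p)) G"
  have "consistent T (insert (Neg (subst1 p x (Var (fresh_for ?G)))) ?G)"
    using 1 by (intro consistent_witness) (use fresh_for in blast)+
  then show ?case by (simp add: insert_commute)
qed auto

primrec henkin :: "fm set \<Rightarrow> fm set \<Rightarrow> nat \<Rightarrow> fm set" where
  "henkin T G 0 = G"
| "henkin T G (Suc n) =
     (let H = henkin T G n; p = from_nat n
      in if consistent T (insert p H) then witness H p \<union> insert p H else H)"

lemma finite_henkin: "finite G \<Longrightarrow> finite (henkin T G n)"
  by (induction n) (auto simp: Let_def)

lemma consistent_henkin:
  "finite G \<Longrightarrow> consistent T G \<Longrightarrow> consistent T (henkin T G n)"
  by (induction n) (auto simp: Let_def finite_henkin simp del: Un_insert_right intro!: consistent_add_witness)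

lemma henkin_mono: "m \<le> n \<Longrightarrow> henkin T G m \<subseteq> henkin T G n"
  by (rule lift_Suc_mono_le[of "henkin T G"]) (auto simp: Let_def)

section \<open>Maximal consistent sets with witnesses and their term models\<close>

locale henkin_set =
  fixes T H :: "fm set"
  assumes H_consistent: "consistent T H"
    and H_maximal: "consistent T (insert p H) \<Longrightarrow> p \<in> H"
    and H_witness: "Neg (All x p) \<in> H \<Longrightarrow> \<exists>z. Neg (subst1 p x (Var z)) \<in> H"
begin

lemma H_ded: "ded T H p \<Longrightarrow> p \<in> H"
proof (rule H_maximal, rule ccontr)
  assume "ded T H p" "\<not> consistent T (insert p H)"
  then have "ded T H q" for q
    by (meson consistent_def deduction ded.Mp)
  then show False using H_consistent by (simp add: consistent_def)
qed

lemma H_provable: "provable T p \<Longrightarrow> p \<in> H"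
  by (simp add: H_ded ded.Thm)

lemma H_MP: "Imp p q \<in> H \<Longrightarrow> p \<in> H \<Longrightarrow> q \<in> H"
  by (meson H_ded ded.Mp ded.Hyp)

lemma H_Neg: "Neg p \<in> H \<longleftrightarrow> p \<notin> H"
proof
  show "Neg p \<in> H \<Longrightarrow> p \<notin> H"
    using H_consistent by (meson consistent_def ded_explode ded.Hyp)
  show "p \<notin> H \<Longrightarrow> Neg p \<in> H"
    using H_maximal H_consistent ded_Neg_if_inconsistent H_ded by blast
qed

lemma H_Imp: "Imp p q \<in> H \<longleftrightarrow> (p \<in> H \<longrightarrow> q \<in> H)"
proof
  assume *: "p \<in> H \<longrightarrow> q \<in> H"
  show "Imp p q \<in> H"
  proof (cases "p \<in> H")
    case True
    then show ?thesis using * by (meson H_MP H_provable provable.P1)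
  next
    case False
    then have "Neg p \<in> H" by (simp add: H_Neg)
    then show ?thesis
      by (meson H_ded deduction ded_explode ded.Hyp insertI1 insertI2)
  qed
qed (use H_MP in blast)

text \<open>One direction is the axiom \<open>Inst\<close>; for the other, \<open>H_witness\<close>
  supplies an instance that fails.\<close>

lemma H_All: "All x p \<in> H \<longleftrightarrow> (\<forall>t. subst1 p x t \<in> H)"
  using H_witness H_Neg by (meson H_MP H_provable provable.Inst)

lemma H_Eq_refl: "Eq t t \<in> H"
  by (simp add: H_provable provable.Refl)

lemma H_Eq_sym: "Eq s t \<in> H \<Longrightarrow> Eq t s \<in> H"
  by (meson H_MP H_provable provable.Eq_cong H_Eq_refl)

lemma H_Eq_trans: "Eq s t \<in> H \<Longrightarrow> Eq t u \<in> H \<Longrightarrow> Eq s u \<in> H"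
  by (meson H_MP H_provable provable.Eq_cong H_Eq_refl H_Eq_sym)

definition eqr :: "(trm \<times> trm) set" where
  "eqr = {(s, t). Eq s t \<in> H}"

lemma equiv_eqr: "equiv UNIV eqr"
  by (rule equivI) (auto simp: eqr_def refl_on_def sym_def trans_def
      intro: H_Eq_refl H_Eq_sym H_Eq_trans)

text \<open>The domain of a structure is a whole type, so the quotient term model is
  transported to \<open>nat\<close>; this needs infinitely many classes.\<close>

definition cls :: "trm \<Rightarrow> nat" where
  "cls t = to_nat_on (UNIV // eqr) (eqr `` {t})"

definition rep :: "nat \<Rightarrow> trm" where
  "rep n = inv cls n"

definition term_model :: "nat interp" where
  "term_model = \<lparr>izero = cls Zero, ione = cls One,
     iplus = (\<lambda>m n. cls (Plus (rep m) (rep n))),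
     itimes = (\<lambda>m n. cls (Times (rep m) (rep n))),
     iless = (\<lambda>m n. Less (rep m) (rep n) \<in> H)\<rparr>"

end

locale infinite_henkin_set = henkin_set +
  assumes infinite_quotient: "infinite (UNIV // eqr)"
begin

lemma countable_quotient: "countable (UNIV // eqr)"
  by (simp add: quotient_def)

lemma cls_eq: "cls s = cls t \<longleftrightarrow> Eq s t \<in> H"
proof -
  have "cls s = cls t \<longleftrightarrow> eqr `` {s} = eqr `` {t}"
    unfolding cls_def using countable_quotient by (subst to_nat_on_inj) (auto intro: quotientI)
  then show ?thesis using equiv_eqr eq_equiv_class_iff[of UNIV eqr s t] by (simp add: eqr_def)
qed

lemma cls_surj: "surj cls"
proof -
  have "to_nat_on (UNIV // eqr) ` (UNIV // eqr) = UNIV"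
    using to_nat_on_infinite[OF countable_quotient infinite_quotient] by (simp add: bij_betw_def)
  moreover have "UNIV // eqr = range (\<lambda>t. eqr `` {t})" by (auto simp: quotient_def)
  ultimately show ?thesis by (auto simp: cls_def image_image)
qed

lemma cls_rep [simp]: "cls (rep n) = n"
  by (simp add: rep_def cls_surj surj_f_inv_f)

lemma rep_cls: "Eq (rep (cls t)) t \<in> H"
  by (metis cls_eq cls_rep)

lemma val_cls: "val term_model (\<lambda>x. cls (Var x)) t = cls t"
proof (induction t)
  case (Plus s t)
  then show ?case
    by (auto simp: term_model_def cls_eq intro!: H_MP[OF H_MP[OF H_provable[OF provable.Plus_cong]]] rep_cls)
next
  case (Times s t)
  then show ?case
    by (auto simp: term_model_def cls_eq intro!: H_MP[OF H_MP[OF H_provable[OF provable.Times_cong]]] rep_cls)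
qed (simp_all add: term_model_def)

lemma Less_rep: "Less (rep (cls s)) (rep (cls t)) \<in> H \<longleftrightarrow> Less s t \<in> H"
  by (meson H_MP H_provable provable.Less_cong rep_cls H_Eq_sym)

text \<open>The quantifier case of the truth lemma refers to instances \<open>subst1 q x t\<close>.
  They are not subformulas, but substitution preserves the depth, so the induction runs on
  it.\<close>

primrec depth :: "fm \<Rightarrow> nat" where
  "depth (Eq s t) = 0"
| "depth (Less s t) = 0"
| "depth (Neg p) = Suc (depth p)"
| "depth (Imp p q) = Suc (depth p + depth q)"
| "depth (All x p) = Suc (depth p)"

lemma depth_subst [simp]: "depth (subst p s) = depth p"
  by (induction p arbitrary: s) (auto simp: Let_def)

lemma truth: "sat term_model (\<lambda>x. cls (Var x)) p \<longleftrightarrow> p \<in> H"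
proof (induction "depth p" arbitrary: p rule: less_induct)
  case less
  show ?case
  proof (cases p)
    case (Eq s t)
    then show ?thesis by (simp add: val_cls cls_eq)
  next
    case (Less s t)
    have "iless term_model (cls s) (cls t) \<longleftrightarrow> Less s t \<in> H"
      by (simp add: term_model_def Less_rep)
    then show ?thesis using Less by (simp add: val_cls)
  next
    case (Neg q)
    then show ?thesis using less[of q] by (simp add: H_Neg)
  next
    case (Imp q r)
    then show ?thesis using less[of q] less[of r] by (simp add: H_Imp)
  next
    case (All x q)
    have "sat term_model ((\<lambda>x. cls (Var x))(x := cls t)) q \<longleftrightarrow> subst1 q x t \<in> H" for t
      using less[of "subst1 q x t"] All by (simp add: sat_subst1 val_cls) (simp add: subst1_def)
    then have "(\<forall>t. sat term_model ((\<lambda>x. cls (Var x))(x := cls t)) q) \<longleftrightarrow> All x q \<in> H"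
      by (simp add: H_All)
    \<comment> \<open>Every element of the domain is the class of a term, so quantifying over terms
      and over elements is the same.\<close>
    moreover have "(\<forall>t. P (cls t)) \<longleftrightarrow> (\<forall>a. P a)" for P by (metis cls_rep)
    note this[of "\<lambda>a. sat term_model ((\<lambda>x. cls (Var x))(x := a)) q"]
    ultimately show ?thesis by (simp only: \<open>p = All x q\<close> sat.simps)
  qed
qed

text \<open>The truth lemma speaks only of the assignment that sends each variable to its own class.
  The universal closure is provable by \<open>Gen\<close>, and evaluating it there reaches all other
  assignments.\<close>

lemma provable_valid:
  assumes "provable T p" shows "sat term_model v p"
proof -
  have close: "provable T (foldr All ys p)" for ys
    by (induction ys) (auto intro: assms provable.Gen)
  have inst: "sat M v p" if "sat M u (foldr All ys p)" "\<And>x. x \<notin> set ys \<Longrightarrow> u x = v x"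
    for M :: "nat interp" and u v ys
    using that
  proof (induction ys arbitrary: u)
    case Nil
    then have "u = v" by auto
    then show ?case using Nil by simp
  next
    case (Cons y ys)
    have "sat M (u(y := v y)) (foldr All ys p)"
      using Cons.prems(1) by (simp only: foldr.simps o_apply sat.simps)
    then show ?case by (rule Cons.IH) (use Cons.prems(2) in auto)
  qed
  obtain ys where ys: "set ys = fvars p" using finite_list[OF finite_fvars] by blast
  define w where "w x = (if x \<in> fvars p then v x else cls (Var x))" for x
  have "sat term_model (\<lambda>x. cls (Var x)) (foldr All ys p)"
    unfolding truth by (rule H_provable[OF close])
  then have "sat term_model w p" by (rule inst) (simp add: ys w_def)
  moreover have "sat term_model w p = sat term_model v p" by (rule sat_cong) (simp add: w_def)
  ultimately show ?thesis by simp
qed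

lemma term_model: "is_model term_model T"
  by (simp add: is_model_def provable_valid provable.Axiom)

end

text \<open>A contradiction uses finitely many hypotheses, so it would already arise at some stage.
  A formula consistent with the union is consistent with the stage that considers it, hence was
  added there along with its witness.\<close>

lemma henkin_set_exists:
  assumes "finite G" "consistent T G"
  obtains H where "G \<subseteq> H" "henkin_set T H"
proof
  define H where "H = (\<Union>n. henkin T G n)"
  show "G \<subseteq> H" unfolding H_def using henkin.simps(1) by blast
  have fin: "\<exists>n. D \<subseteq> henkin T G n" if "finite D" "D \<subseteq> H" for D
    using that
  proof (induction D rule: finite_induct)
    case (insert p D)
    then obtain m n where "D \<subseteq> henkin T G m" "p \<in> henkin T G n" by (auto simp: H_def)
    then have "insert p D \<subseteq> henkin T G (max m n)"
      using henkin_mono[of m "max m n"] henkin_mono[of n "max m n"] by fastforce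
    then show ?case ..
  qed auto
  have cons: "consistent T (henkin T G n)" for n by (rule consistent_henkin[OF assms])
  have step: "p \<in> H \<and> witness (henkin T G (to_nat p)) p \<subseteq> H"
    if "consistent T (insert p (henkin T G (to_nat p)))" for p
  proof -
    have "witness (henkin T G (to_nat p)) p \<union> insert p (henkin T G (to_nat p))
        = henkin T G (Suc (to_nat p))" using that by (simp add: Let_def)
    then show ?thesis unfolding H_def by blast
  qed
  have mono: "consistent T A" if "consistent T B" "A \<subseteq> B" for A B
    using that by (meson consistent_def ded_mono)
  show "henkin_set T H"
  proof
    show H: "consistent T H"
    proof (rule ccontr)
      assume "\<not> consistent T H"
      then have "ded T H (Eq Zero Zero)" "ded T H (Neg (Eq Zero Zero))"
        by (auto simp: consistent_def)
      then obtain D E where D: "finite D" "D \<subseteq> H" "ded T D (Eq Zero Zero)"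
        and E: "finite E" "E \<subseteq> H" "ded T E (Neg (Eq Zero Zero))"
        by (meson ded_finite)
      then obtain n where "D \<union> E \<subseteq> henkin T G n" using fin[of "D \<union> E"] by auto
      then have "ded T (henkin T G n) q" for q
        using D E by (meson ded_explode ded_mono le_sup_iff)
      then show False using cons[of n] unfolding consistent_def by blast
    qed
    have sub: "insert p (henkin T G n) \<subseteq> insert p H" for p n by (auto simp: H_def)
    show "p \<in> H" if "consistent T (insert p H)" for p
      using step mono[OF that sub] by blast
    show "\<exists>z. Neg (subst1 p x (Var z)) \<in> H" if "Neg (All x p) \<in> H" for x p
    proof -
      have "insert (Neg (All x p)) H = H" using that by auto
      then have "consistent T (insert (Neg (All x p)) (henkin T G (to_nat (Neg (All x p)))))"
        using mono[OF H] sub by metis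
      then have "witness (henkin T G (to_nat (Neg (All x p)))) (Neg (All x p)) \<subseteq> H"
        using step by blast
      then show ?thesis by auto
    qed
  qed
qed

primrec numl :: "nat \<Rightarrow> trm" where
  "numl 0 = Zero"
| "numl (Suc n) = Plus (numl n) One"

text \<open>The numerals lie in pairwise different classes: injectivity strips successors from an
  equation of numerals until one side is zero.\<close>

lemma PA_infinite_quotient:
  assumes "PA \<subseteq> T" "henkin_set T H"
  shows "infinite (UNIV // henkin_set.eqr H)"
proof -
  interpret henkin_set T H by fact
  have inst: "provable T q \<Longrightarrow> provable T (subst1 q x t)" for q x t
    by (meson provable.Gen provable.Inst provable.MP)
  have zero: "Neg (Eq (Plus t One) Zero) \<in> H" for t
  proof -
    have "provable T (Neg (Eq (Plus (Var 0) One) Zero))"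
      using assms(1) by (auto intro!: provable.Axiom PA.intros)
    from inst[OF this, of 0 t] show ?thesis by (simp add: subst1_def H_provable)
  qed
  \<comment> \<open>Numerals are closed, so the two variables of \<open>Succ_inject\<close> can be
    instantiated one after the other.\<close>
  have closed [simp]: "tsubst (numl n) s = numl n" for n s by (induction n) auto
  have inj: "Imp (Eq (Plus (numl m) One) (Plus (numl n) One)) (Eq (numl m) (numl n)) \<in> H" for m n
  proof -
    have "provable T (Imp (Eq (Plus (Var 0) One) (Plus (Var 1) One)) (Eq (Var 0) (Var 1)))"
      using assms(1) PA.Succ_inject by (blast intro: provable.Axiom)
    from inst[OF inst[OF this, of 0 "numl m"], of 1 "numl n"] show ?thesis
      by (simp add: subst1_def H_provable)
  qed
  have numl: "Eq (numl m) (numl n) \<in> H \<Longrightarrow> m = n" for m n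
  proof (induction m arbitrary: n)
    case 0
    then have "Eq (numl n) Zero \<in> H" using H_Eq_sym by simp
    then show ?case using zero by (cases n) (simp_all add: H_Neg)
  next
    case (Suc m)
    show ?case
    proof (cases n)
      case 0
      then show ?thesis using Suc.prems zero[of "numl m"] by (simp add: H_Neg)
    next
      case (Suc k)
      then have "Eq (numl m) (numl k) \<in> H" using Suc.prems H_MP[OF inj] by simp
      then show ?thesis using Suc Suc.IH by simp
    qed
  qed
  have "inj (\<lambda>n. eqr `` {numl n})"
    using numl eq_equiv_class_iff[OF equiv_eqr] by (auto simp: inj_def eqr_def)
  then have "infinite (range (\<lambda>n. eqr `` {numl n}))" using range_inj_infinite by blast
  moreover have "range (\<lambda>n. eqr `` {numl n}) \<subseteq> UNIV // eqr" by (auto intro: quotientI)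
  ultimately show ?thesis using finite_subset by blast
qed

text \<open>An axiom system that forces an infinite domain is essential: a theory with finite models
  only has no model with domain \<open>nat\<close>, and the validity assumption would be
  vacuous.\<close>

theorem completeness:
  assumes "PA \<subseteq> T" and valid: "\<And>(M :: nat interp) v. is_model M T \<Longrightarrow> sat M v p"
  shows "provable T p"
proof (rule ccontr)
  assume "\<not> provable T p"
  then have "\<not> ded T {} p" using ded_empty by blast
  then have "consistent T {Neg p}"
    by (metis consistent_def ded_by_contra)
  then obtain H where H: "{Neg p} \<subseteq> H" "henkin_set T H"
    using henkin_set_exists[of "{Neg p}" T] by blast
  interpret henkin_set T H by (rule H)
  interpret infinite_henkin_set T H
    by unfold_locales (rule PA_infinite_quotient[OF assms(1) H(2)])
  have "sat term_model (\<lambda>x. cls (Var x)) (Neg p)" using truth H by blast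
  then show False using valid[OF term_model] by simp
qed

section \<open>Arithmetic in models of PA\<close>

locale pa_model =
  fixes M :: "'a interp"
  assumes PA: "is_model M PA"
begin

abbreviation (input) add (infixl "\<oplus>" 65) where "add \<equiv> iplus M"
abbreviation (input) mul (infixl "\<otimes>" 70) where "mul \<equiv> itimes M"
abbreviation (input) zer ("\<zero>") where "zer \<equiv> izero M"
abbreviation (input) one ("\<one>") where "one \<equiv> ione M"
abbreviation (input) lt (infix "\<prec>" 50) where "lt \<equiv> iless M"

lemma axiom: "p \<in> PA \<Longrightarrow> sat M v p"
  using PA by (simp add: is_model_def)

text \<open>\<open>sat_subst1\<close> turns the substitutions of the axiom into updates of the
  assignment. In the applications below, variable 0 usually carries the induction and the other
  numbered variables hold the parameters.\<close>

lemma induct: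
  assumes "sat M (v(x := \<zero>)) p" and "\<And>a. sat M (v(x := a)) p \<Longrightarrow> sat M (v(x := a \<oplus> \<one>)) p"
  shows "sat M (v(x := a)) p"
  using axiom[OF PA.Induction, of v p x] assms by (auto simp: sat_subst1)

lemma Suc_neq_0 [simp]: "a \<oplus> \<one> \<noteq> \<zero>"
  using axiom[OF PA.Succ_neq_0, of "\<lambda>_. a"] by simp

lemma Suc_inject [simp]: "a \<oplus> \<one> = b \<oplus> \<one> \<longleftrightarrow> a = b"
  using axiom[OF PA.Succ_inject, of "undefined(0 := a, 1 := b)"] by auto

lemma add_0_right [simp]: "a \<oplus> \<zero> = a"
  using axiom[OF PA.Plus_0, of "\<lambda>_. a"] by simp

lemma add_Suc: "a \<oplus> (b \<oplus> \<one>) = (a \<oplus> b) \<oplus> \<one>"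
  using axiom[OF PA.Plus_Succ, of "undefined(0 := a, 1 := b)"] by simp

lemma mult_0_right [simp]: "a \<otimes> \<zero> = \<zero>"
  using axiom[OF PA.Times_0, of "\<lambda>_. a"] by simp

lemma mult_Suc: "a \<otimes> (b \<oplus> \<one>) = (a \<otimes> b) \<oplus> a"
  using axiom[OF PA.Times_Succ, of "undefined(0 := a, 1 := b)"] by simp

lemma not_less_0 [simp]: "\<not> a \<prec> \<zero>"
  using axiom[OF PA.Not_less_0, of "\<lambda>_. a"] by simp

lemma less_Suc: "a \<prec> b \<oplus> \<one> \<longleftrightarrow> a \<prec> b \<or> a = b"
  using axiom[OF PA.Less_SuccD, of "undefined(0 := a, 1 := b)"]
    axiom[OF PA.Less_SuccI, of "undefined(0 := a, 1 := b)"] by auto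

lemma add_0_left [simp]: "\<zero> \<oplus> a = a"
  using induct[of "\<lambda>_. a" 0 "Eq (Plus Zero (Var 0)) (Var 0)" a] by (simp add: add_Suc)

lemma add_assoc: "(a \<oplus> b) \<oplus> c = a \<oplus> (b \<oplus> c)"
  using induct[of "undefined(1 := a, 2 := b)" 0
      "Eq (Plus (Plus (Var 1) (Var 2)) (Var 0)) (Plus (Var 1) (Plus (Var 2) (Var 0)))" c]
  by (simp add: add_Suc)

lemma add_Suc_left: "(a \<oplus> \<one>) \<oplus> b = (a \<oplus> b) \<oplus> \<one>"
  using induct[of "undefined(1 := a)" 0
      "Eq (Plus (Plus (Var 1) One) (Var 0)) (Plus (Plus (Var 1) (Var 0)) One)" b]
  by (simp add: add_Suc)

lemma add_commute: "a \<oplus> b = b \<oplus> a"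
  using induct[of "undefined(1 := a)" 0 "Eq (Plus (Var 1) (Var 0)) (Plus (Var 0) (Var 1))" b]
  by (simp add: add_Suc add_Suc_left)

lemma add_left_commute: "a \<oplus> (b \<oplus> c) = b \<oplus> (a \<oplus> c)"
  by (metis add_assoc add_commute)

lemmas add_ac = add_assoc add_commute add_left_commute

lemma add_left_cancel: "c \<oplus> a = c \<oplus> b \<longleftrightarrow> a = b"
proof -
  have "a \<oplus> c = b \<oplus> c \<longrightarrow> a = b"
    using induct[of "undefined(1 := a, 2 := b)" 0
      "Imp (Eq (Plus (Var 1) (Var 0)) (Plus (Var 2) (Var 0))) (Eq (Var 1) (Var 2))" c]
    by (simp add: add_Suc)
  then show ?thesis by (auto simp: add_commute)
qed

lemma mult_0_left [simp]: "\<zero> \<otimes> a = \<zero>"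
  using induct[of undefined 0 "Eq (Times Zero (Var 0)) Zero" a] by (simp add: mult_Suc)

lemma mult_Suc_left: "(a \<oplus> \<one>) \<otimes> b = (a \<otimes> b) \<oplus> b"
proof -
  have "(x \<oplus> y) \<oplus> (a \<oplus> \<one>) = ((x \<oplus> a) \<oplus> (y \<oplus> \<one>))" for x y
    by (simp add: add_ac)
  then show ?thesis
    using induct[of "undefined(1 := a)" 0
      "Eq (Times (Plus (Var 1) One) (Var 0)) (Plus (Times (Var 1) (Var 0)) (Var 0))" b]
    by (simp add: mult_Suc)
qed

lemma mult_commute: "a \<otimes> b = b \<otimes> a"
  using induct[of "undefined(1 := a)" 0 "Eq (Times (Var 1) (Var 0)) (Times (Var 0) (Var 1))" b]
  by (simp add: mult_Suc mult_Suc_left)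

lemma mult_add: "a \<otimes> (b \<oplus> c) = (a \<otimes> b) \<oplus> (a \<otimes> c)"
  using induct[of "undefined(1 := a, 2 := b)" 0
      "Eq (Times (Var 1) (Plus (Var 2) (Var 0))) (Plus (Times (Var 1) (Var 2)) (Times (Var 1) (Var 0)))" c]
  by (simp add: mult_Suc flip: add_assoc)

lemma mult_one [simp]: "a \<otimes> \<one> = a"
  using mult_Suc[of a "\<zero>"] by simp

lemma mult_assoc: "(a \<otimes> b) \<otimes> c = a \<otimes> (b \<otimes> c)"
  using induct[of "undefined(1 := a, 2 := b)" 0
      "Eq (Times (Times (Var 1) (Var 2)) (Var 0)) (Times (Var 1) (Times (Var 2) (Var 0)))" c]
  by (simp add: mult_add)

lemma cases_Suc: "a = \<zero> \<or> (\<exists>b. a = b \<oplus> \<one>)"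
  using induct[of undefined 0 "Or (Eq (Var 0) Zero) (Exists 1 (Eq (Var 0) (Plus (Var 1) One)))" a]
  by auto

section \<open>The order and ordered-semiring structure of a model\<close>

definition le (infix "\<preceq>" 50) where "a \<preceq> b \<longleftrightarrow> a \<prec> b \<or> a = b"

text \<open>The axioms describe \<open><\<close> only by recursion on its right argument. Expressing
  it by addition reduces its other properties to the laws of addition.\<close>

lemma le_iff: "a \<preceq> b \<longleftrightarrow> (\<exists>c. b = a \<oplus> c)"
proof
  have "\<exists>e. (a \<oplus> c) \<oplus> \<one> = a \<oplus> e" for c by (metis add_Suc)
  moreover have "\<exists>e. a \<oplus> \<one> = a \<oplus> e" by blast
  moreover have "\<exists>e. a = a \<oplus> e" by (metis add_0_right)
  ultimately show "a \<preceq> b \<Longrightarrow> \<exists>c. b = a \<oplus> c"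
    using induct[of "undefined(1 := a)" 0
      "Imp (Or (Less (Var 1) (Var 0)) (Eq (Var 1) (Var 0))) (Exists 2 (Eq (Var 0) (Plus (Var 1) (Var 2))))" b]
    by (fastforce simp: le_def less_Suc)
  have "a \<preceq> a \<oplus> c" for c
    using induct[of "undefined(1 := a)" 0
      "Or (Less (Var 1) (Plus (Var 1) (Var 0))) (Eq (Var 1) (Plus (Var 1) (Var 0)))" c]
    by (fastforce simp: le_def less_Suc add_Suc)
  then show "\<exists>c. b = a \<oplus> c \<Longrightarrow> a \<preceq> b" by blast
qed

lemma not_less_self: "\<not> a \<prec> a"
proof
  assume a: "a \<prec> a"
  then obtain b where b: "a = b \<oplus> \<one>" using cases_Suc[of a] by auto
  then have "a \<preceq> b" using a by (simp add: le_def less_Suc)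
  then obtain c where "b = a \<oplus> c" using le_iff by blast
  then have "b \<oplus> \<zero> = b \<oplus> (c \<oplus> \<one>)" using b by (simp add: add_ac)
  then show False unfolding add_left_cancel by (metis Suc_neq_0)
qed

lemma less_iff: "a \<prec> b \<longleftrightarrow> (\<exists>c. b = (a \<oplus> c) \<oplus> \<one>)"
proof
  assume "a \<prec> b"
  then obtain c where c: "b = a \<oplus> c" using le_iff by (auto simp: le_def)
  then have "c \<noteq> \<zero>" using \<open>a \<prec> b\<close> not_less_self by auto
  then show "\<exists>c. b = (a \<oplus> c) \<oplus> \<one>" using c cases_Suc[of c] by (auto simp: add_Suc)
next
  assume "\<exists>c. b = (a \<oplus> c) \<oplus> \<one>"
  then show "a \<prec> b" using le_iff by (auto simp: less_Suc le_def)
qed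

lemma le_linear: "a \<preceq> b \<or> b \<preceq> a"
proof -
  have 0: "\<zero> \<preceq> b" using le_iff[of "\<zero>" b] by simp
  have "a \<oplus> \<one> \<preceq> b \<or> b \<preceq> a \<oplus> \<one>" if ab: "a \<preceq> b \<or> b \<preceq> a" for a
  proof (cases "a \<prec> b")
    case True
    then show ?thesis by (auto simp: less_iff le_iff add_ac)
  next
    case False
    then have "b \<preceq> a" using ab by (auto simp: le_def)
    then show ?thesis by (simp add: le_def less_Suc)
  qed
  then show ?thesis
    using 0 induct[of "undefined(1 := b)" 0
      "Or (Or (Less (Var 0) (Var 1)) (Eq (Var 0) (Var 1))) (Or (Less (Var 1) (Var 0)) (Eq (Var 1) (Var 0)))" a]
    unfolding le_def by auto
qed

lemma le_antisym: "a \<preceq> b \<Longrightarrow> b \<preceq> a \<Longrightarrow> a = b"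
proof -
  assume "a \<preceq> b" "b \<preceq> a"
  then obtain c d where cd: "b = a \<oplus> c" "a = b \<oplus> d" by (auto simp: le_iff)
  then have "a \<oplus> \<zero> = a \<oplus> (c \<oplus> d)" by (metis add_assoc add_0_right)
  then have "c \<oplus> d = \<zero>" unfolding add_left_cancel by simp
  then have "d = \<zero>" using cases_Suc[of d] by (auto simp: add_Suc)
  then show ?thesis using cd by simp
qed

text \<open>\<open>linordered_semidom\<close> asks for a truncated subtraction. It is supplied so
  that the sublocale below makes \<open>algebra_simps\<close> and the rules for ordered semirings
  available in \<open>M\<close>.\<close>

definition monus (infixl "\<ominus>" 65) where
  "a \<ominus> b = (if b \<preceq> a then THE c. a = b \<oplus> c else \<zero>)"

lemma monus_add [simp]: "a \<oplus> b \<ominus> a = b"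
proof -
  have "a \<preceq> a \<oplus> b" by (auto simp: le_iff)
  then show ?thesis by (simp add: monus_def add_left_cancel)
qed

lemma monus_eq_0: "a \<preceq> b \<Longrightarrow> a \<ominus> b = \<zero>"
  using monus_add[of a "\<zero>"] le_antisym[of a b] by (cases "a = b") (auto simp: monus_def)

lemma monus_cases: obtains c where "a = b \<oplus> c" "a \<ominus> b = c" | c where "b = a \<oplus> c" "a \<ominus> b = \<zero>"
  using le_linear[of a b] that monus_add monus_eq_0 by (metis le_iff)

lemma monus_add_add: "a \<oplus> b \<ominus> (a \<oplus> c) = b \<ominus> c"
proof (cases b c rule: monus_cases)
  case (1 d)
  then show ?thesis using monus_add[of "a \<oplus> c" d] by (simp add: add_assoc)
next
  case (2 d)
  then have "a \<oplus> b \<preceq> a \<oplus> c" by (auto simp: le_iff add_assoc)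
  then show ?thesis using 2 by (simp add: monus_eq_0)
qed

lemma monus_monus: "a \<ominus> b \<ominus> c = a \<ominus> (b \<oplus> c)"
proof (cases a b rule: monus_cases)
  case (1 d)
  then show ?thesis using monus_add_add[of b d c] by simp
next
  case (2 d)
  have "\<zero> \<preceq> c" "a \<preceq> a \<oplus> (d \<oplus> c)" by (auto simp: le_iff)
  then show ?thesis using 2 by (simp add: add_assoc monus_eq_0)
qed

lemma mult_monus: "a \<otimes> (b \<ominus> c) = (a \<otimes> b) \<ominus> (a \<otimes> c)"
proof (cases b c rule: monus_cases)
  case (1 d)
  then show ?thesis by (simp add: mult_add)
next
  case (2 d)
  then have "a \<otimes> b \<preceq> a \<otimes> c" by (auto simp: le_iff mult_add)
  then show ?thesis using 2 by (simp add: monus_eq_0)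
qed

lemma le_add_monus: "b \<preceq> a \<Longrightarrow> (a \<ominus> b) \<oplus> b = a"
  by (auto simp: le_iff) (simp add: add_commute)

lemma le_trans: "a \<preceq> b \<Longrightarrow> b \<preceq> c \<Longrightarrow> a \<preceq> c"
  by (auto simp: le_iff add_assoc)

lemma zero_less_Suc: "\<zero> \<prec> a \<oplus> \<one>"
  by (auto simp: less_iff)

lemma mult_eq_0: "a \<otimes> b = \<zero> \<Longrightarrow> a = \<zero> \<or> b = \<zero>"
  using cases_Suc[of a] cases_Suc[of b] by (auto simp: mult_Suc add_Suc)

lemma mult_strict: "a \<prec> b \<Longrightarrow> \<zero> \<prec> c \<Longrightarrow> c \<otimes> a \<prec> c \<otimes> b"
proof -
  assume "a \<prec> b" "\<zero> \<prec> c"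
  then obtain d e where "b = (a \<oplus> d) \<oplus> \<one>" "c = (\<zero> \<oplus> e) \<oplus> \<one>" by (auto simp: less_iff)
  then have "c \<otimes> b = ((c \<otimes> a \<oplus> c \<otimes> d) \<oplus> e) \<oplus> \<one>"
    by (simp add: mult_add add_assoc)
  then have "\<exists>f. c \<otimes> b = (c \<otimes> a \<oplus> f) \<oplus> \<one>" by (metis add_assoc)
  then show ?thesis by (simp add: less_iff)
qed

end

sublocale pa_model \<subseteq> sr: linordered_semidom "iplus M" monus le "iless M" "izero M" "itimes M" "ione M"
proof unfold_locales
  show "a \<prec> b \<longleftrightarrow> a \<preceq> b \<and> \<not> b \<preceq> a" for a b
    using le_linear[of a b] le_antisym not_less_self by (metis le_def)
  show "a \<preceq> b \<or> b \<preceq> a" for a b by (rule le_linear)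
  show "a \<preceq> b \<Longrightarrow> c \<oplus> a \<preceq> c \<oplus> b" for a b c
    by (auto simp: le_iff add_assoc)
  show "(a \<oplus> b) \<otimes> c = (a \<otimes> c) \<oplus> (b \<otimes> c)" for a b c
    by (metis mult_add mult_commute)
  show "\<one> \<otimes> a = a" for a by (metis mult_commute mult_one)
  show "\<zero> \<noteq> \<one>" using Suc_neq_0[of "\<zero>"] by simp
  then show "\<zero> \<prec> \<one>" using zero_less_Suc[of "\<zero>"] by simp
  show "a \<otimes> b \<noteq> \<zero>" if "a \<noteq> \<zero>" "b \<noteq> \<zero>" for a b
    using that mult_eq_0 by blast
qed (fact add_assoc add_commute add_0_left monus_add monus_monus le_antisym le_trans mult_assoc
    mult_commute mult_monus mult_add mult_strict le_add_monus | simp add: le_def)+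

context pa_model begin

text \<open>This rule would fold sums of ones into numerals, which the axioms and the induction
  formulas do not use.\<close>

declare sr.one_add_one [simp del]

section \<open>The Cantor pairing function\<close>

definition pairM :: "'a \<Rightarrow> 'a \<Rightarrow> 'a \<Rightarrow> bool" where
  "pairM x y z \<longleftrightarrow> (\<exists>u. (u \<oplus> u = (x \<oplus> y \<oplus> \<one>) \<otimes> (x \<oplus> y) \<or> u \<oplus> u \<oplus> \<one> = (x \<oplus> y \<oplus> \<one>) \<otimes> (x \<oplus> y))
     \<and> z = u \<oplus> y)"

lemma le_self_add [simp]: "a \<preceq> a \<oplus> b"
  by (auto simp: le_iff)

lemma zero_le [simp]: "\<zero> \<preceq> a"
  by (auto simp: le_iff)

lemma less_Suc_le: "a \<prec> b \<oplus> \<one> \<longleftrightarrow> a \<preceq> b"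
  by (simp add: le_def less_Suc)

lemma Suc_le_iff: "a \<oplus> \<one> \<preceq> b \<longleftrightarrow> a \<prec> b"
  by (auto simp: le_iff less_iff algebra_simps)

text \<open>Triangular numbers: \<open>u\<close> is the one with index \<open>s\<close>, and the
  next exceeds it by \<open>s + 1\<close>.\<close>

lemma half_Suc:
  assumes "u \<oplus> u = (s \<oplus> \<one>) \<otimes> s"
  shows "(u \<oplus> s \<oplus> \<one>) \<oplus> (u \<oplus> s \<oplus> \<one>) = (s \<oplus> \<one> \<oplus> \<one>) \<otimes> (s \<oplus> \<one>)"
proof -
  have "(u \<oplus> s \<oplus> \<one>) \<oplus> (u \<oplus> s \<oplus> \<one>) = (u \<oplus> u) \<oplus> ((s \<oplus> \<one>) \<oplus> (s \<oplus> \<one>))"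
    by (simp add: algebra_simps)
  also have "\<dots> = (s \<oplus> \<one> \<oplus> \<one>) \<otimes> (s \<oplus> \<one>)" unfolding assms by (simp add: algebra_simps)
  finally show ?thesis .
qed

lemma half_exists: "\<exists>u. u \<oplus> u = (s \<oplus> \<one>) \<otimes> s"
proof -
  have "\<exists>u'. u' \<oplus> u' = (s \<oplus> \<one> \<oplus> \<one>) \<otimes> (s \<oplus> \<one>)" if "u \<oplus> u = (s \<oplus> \<one>) \<otimes> s" for u s
    using half_Suc[OF that] by blast
  moreover have "\<exists>u. u \<oplus> u = \<zero>" by (rule exI[of _ "\<zero>"]) simp
  ultimately show ?thesis
    using induct[of undefined 0
        "Exists 1 (Eq (Plus (Var 1) (Var 1)) (Times (Plus (Var 0) One) (Var 0)))" s] by simp blast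
qed

lemma odd_neq_even: "u \<oplus> u \<oplus> \<one> \<noteq> v \<oplus> v"
proof
  assume *: "u \<oplus> u \<oplus> \<one> = v \<oplus> v"
  show False
  proof (cases "v \<preceq> u")
    case True
    then obtain d where d: "u = v \<oplus> d" by (auto simp: le_iff)
    have "(v \<oplus> v) \<oplus> \<zero> = (v \<oplus> v) \<oplus> (d \<oplus> d \<oplus> \<one>)"
      using * unfolding d by (simp only: sr.add_ac sr.add_0_right)
    then show ?thesis by (metis Suc_neq_0 add_left_cancel)
  next
    case False
    then obtain d where d: "v = u \<oplus> d \<oplus> \<one>" using le_linear[of u v] by (auto simp: le_def less_iff)
    have "(u \<oplus> u \<oplus> \<one>) \<oplus> \<zero> = v \<oplus> v" using * by simp
    also have "\<dots> = (u \<oplus> u \<oplus> \<one>) \<oplus> (d \<oplus> d \<oplus> \<one>)" unfolding d by (simp only: sr.add_ac)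
    finally have "(u \<oplus> u \<oplus> \<one>) \<oplus> \<zero> = (u \<oplus> u \<oplus> \<one>) \<oplus> (d \<oplus> d \<oplus> \<one>)" .
    then show ?thesis by (metis Suc_neq_0 add_left_cancel)
  qed
qed

lemma double_le_iff: "a \<oplus> a \<preceq> b \<oplus> b \<longleftrightarrow> a \<preceq> b"
  by (metis sr.add_mono sr.add_strict_mono sr.leD sr.le_less_linear)

lemma double_inject: "a \<oplus> a = b \<oplus> b \<longleftrightarrow> a = b"
  by (metis double_le_iff le_antisym sr.order_refl)

text \<open>The product of two consecutive elements is even, and \<open>odd_neq_even\<close> then
  excludes the other alternative.\<close>

lemma pairM_iff: "pairM x y z \<longleftrightarrow> (\<exists>u. u \<oplus> u = (x \<oplus> y \<oplus> \<one>) \<otimes> (x \<oplus> y) \<and> z = u \<oplus> y)"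
  unfolding pairM_def by (metis half_exists odd_neq_even)

lemma pairM_exists: "\<exists>z. pairM x y z"
  using half_exists by (auto simp: pairM_iff)

lemma pairM_fun: "pairM x y z \<Longrightarrow> pairM x y z' \<Longrightarrow> z = z'"
  by (auto simp: pairM_iff) (metis double_inject)

text \<open>The pairs with sum \<open>s\<close> form a diagonal whose codes go from the triangular
  number \<open>u\<close> up to \<open>u + s\<close>, while the next triangular number is
  \<open>u + s + 1\<close>.\<close>

lemma pairM_inj_aux:
  assumes "u \<oplus> u = (s \<oplus> \<one>) \<otimes> s" "u' \<oplus> u' = (s' \<oplus> \<one>) \<otimes> s'" "y \<preceq> s" "s \<prec> s'"
  shows "u \<oplus> y \<prec> u'"
proof -
  obtain d where d: "s' = s \<oplus> d \<oplus> \<one>" using assms by (auto simp: less_iff)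
  have "(u \<oplus> s \<oplus> \<one>) \<oplus> (u \<oplus> s \<oplus> \<one>) = (s \<oplus> \<one> \<oplus> \<one>) \<otimes> (s \<oplus> \<one>)"
    using assms(1) by (rule half_Suc)
  also have "\<dots> \<preceq> (s' \<oplus> \<one>) \<otimes> s'"
    unfolding d by (rule sr.mult_mono) (simp_all add: algebra_simps)
  finally have "u \<oplus> s \<oplus> \<one> \<preceq> u'" using assms(2) double_le_iff by metis
  moreover have "u \<oplus> y \<prec> u \<oplus> s \<oplus> \<one>" using assms(3) by (simp add: less_Suc_le)
  ultimately show ?thesis by (rule sr.less_le_trans[rotated])
qed

text \<open>Different diagonals share no code, so the code fixes the sum; the offset on the diagonal
  is then the second component.\<close>

lemma pairM_inj: 
  assumes "pairM x y z" "pairM x' y' z"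
  shows "x = x' \<and> y = y'"
proof -
  obtain u u' where u: "u \<oplus> u = (x \<oplus> y \<oplus> \<one>) \<otimes> (x \<oplus> y)" "z = u \<oplus> y"
     and u': "u' \<oplus> u' = (x' \<oplus> y' \<oplus> \<one>) \<otimes> (x' \<oplus> y')" "z = u' \<oplus> y'"
    using assms by (auto simp: pairM_iff)
  have y: "y \<preceq> x \<oplus> y" "y' \<preceq> x' \<oplus> y'" "u \<preceq> z" "u' \<preceq> z"
    using u(2) u'(2) by (metis le_self_add add_commute)+
  have "\<not> x \<oplus> y \<prec> x' \<oplus> y'" using pairM_inj_aux[OF u(1) u'(1) y(1)] u u' y by auto
  moreover have "\<not> x' \<oplus> y' \<prec> x \<oplus> y" using pairM_inj_aux[OF u'(1) u(1) y(2)] u u' y by auto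
  ultimately have "x \<oplus> y = x' \<oplus> y'" using le_linear by (metis le_def)
  moreover from this have "u = u'" using u u' double_inject by metis
  ultimately show ?thesis using u u' by (metis add_left_cancel add_commute)
qed

section \<open>The beta function in models of PA\<close>

definition modulus :: "'a \<Rightarrow> 'a \<Rightarrow> 'a" where
  "modulus b j = b \<otimes> (j \<oplus> \<one>) \<oplus> \<one>"

definition remM :: "'a \<Rightarrow> 'a \<Rightarrow> 'a \<Rightarrow> bool" where
  "remM a m r \<longleftrightarrow> (\<exists>q. a = q \<otimes> m \<oplus> r) \<and> r \<prec> m"

definition betaM :: "'a \<Rightarrow> 'a \<Rightarrow> 'a \<Rightarrow> bool" where
  "betaM x i r \<longleftrightarrow> (\<exists>a b. pairM a b x \<and> remM a (modulus b i) r)"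

text \<open>Writing the divisor as a successor keeps it positive. In the induction on the dividend
  the remainder grows until it equals \<open>m\<close> and is then reset to zero.\<close>

lemma remM_exists: "\<exists>r. remM a (m \<oplus> \<one>) r"
proof -
  have "\<exists>q r. a \<oplus> \<one> = q \<otimes> (m \<oplus> \<one>) \<oplus> r \<and> r \<prec> m \<oplus> \<one>"
    if "a = q \<otimes> (m \<oplus> \<one>) \<oplus> r" "r \<prec> m \<oplus> \<one>" for a q r
  proof (cases "r = m")
    case True
    then have "a \<oplus> \<one> = (q \<oplus> \<one>) \<otimes> (m \<oplus> \<one>) \<oplus> \<zero>" using that by (simp add: algebra_simps)
    then show ?thesis using zero_less_Suc by blast
  next
    case False
    then have "a \<oplus> \<one> = q \<otimes> (m \<oplus> \<one>) \<oplus> (r \<oplus> \<one>)" "r \<oplus> \<one> \<prec> m \<oplus> \<one>"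
      using that by (simp_all add: algebra_simps less_Suc) (metis Suc_le_iff le_def)
    then show ?thesis by blast
  qed
  then have step: "\<And>a. (\<exists>q r. a = q \<otimes> (m \<oplus> \<one>) \<oplus> r \<and> r \<prec> m \<oplus> \<one>) \<Longrightarrow>
    (\<exists>q r. a \<oplus> \<one> = q \<otimes> (m \<oplus> \<one>) \<oplus> r \<and> r \<prec> m \<oplus> \<one>)" by blast
  have zero: "\<exists>q r. \<zero> = q \<otimes> (m \<oplus> \<one>) \<oplus> r \<and> r \<prec> m \<oplus> \<one>"
    by (rule exI[of _ "\<zero>"], rule exI[of _ "\<zero>"]) (simp add: zero_less_Suc)
  have "\<exists>q r. a = q \<otimes> (m \<oplus> \<one>) \<oplus> r \<and> r \<prec> m \<oplus> \<one>"
    using induct[of "undefined(1 := m)" 0 "Exists 2 (Exists 3 (And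
      (Eq (Var 0) (Plus (Times (Var 2) (Plus (Var 1) One)) (Var 3))) (Less (Var 3) (Plus (Var 1) One))))" a]
     zero step by simp
  then show ?thesis by (auto simp: remM_def)
qed

lemma remM_fun: "remM a m r \<Longrightarrow> remM a m r' \<Longrightarrow> r = r'"
proof -
  have *: "\<not> q \<prec> q'" if "q \<otimes> m \<oplus> r = q' \<otimes> m \<oplus> r'" "r \<prec> m" for q q' r r'
  proof
    assume "q \<prec> q'"
    then obtain d where "q' = q \<oplus> d \<oplus> \<one>" by (auto simp: less_iff)
    then have "(q \<otimes> m) \<oplus> r = (q \<otimes> m) \<oplus> (m \<oplus> (d \<otimes> m \<oplus> r'))" using that by (simp add: algebra_simps)
    then have "r = m \<oplus> (d \<otimes> m \<oplus> r')" unfolding add_left_cancel .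
    then have "m \<preceq> r" by (metis le_self_add)
    then show False using that by auto
  qed
  assume "remM a m r" "remM a m r'"
  then obtain q q' where q: "a = q \<otimes> m \<oplus> r" "a = q' \<otimes> m \<oplus> r'" "r \<prec> m" "r' \<prec> m"
    unfolding remM_def by blast
  then have "\<not> q \<prec> q'" "\<not> q' \<prec> q" using *[of q r q' r'] *[of q' r' q r] by auto
  then have "q = q'" using le_linear by (metis le_def)
  then show ?thesis using q by (metis add_left_cancel)
qed

lemma betaM_fun: "betaM x i r \<Longrightarrow> betaM x i r' \<Longrightarrow> r = r'"
  unfolding betaM_def by (metis remM_fun pairM_inj)

section \<open>Congruences and units, with multiples on both sides in place of negative
  numbers\<close>

definition congM :: "'a \<Rightarrow> 'a \<Rightarrow> 'a \<Rightarrow> bool" where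
  "congM m x y \<longleftrightarrow> (\<exists>s t. x \<oplus> s \<otimes> m = y \<oplus> t \<otimes> m)"

lemma congM_refl [simp]: "congM m x x"
  unfolding congM_def by blast

lemma congM_trans [trans]: "congM m x y \<Longrightarrow> congM m y z \<Longrightarrow> congM m x z"
  unfolding congM_def
proof clarify
  fix s t s' t'
  assume 1: "x \<oplus> s \<otimes> m = y \<oplus> t \<otimes> m" and 2: "y \<oplus> s' \<otimes> m = z \<oplus> t' \<otimes> m"
  have "x \<oplus> (s \<oplus> s') \<otimes> m = (x \<oplus> s \<otimes> m) \<oplus> s' \<otimes> m" by (simp add: algebra_simps)
  also have "\<dots> = (y \<oplus> s' \<otimes> m) \<oplus> t \<otimes> m" unfolding 1 by (simp add: algebra_simps)
  also have "\<dots> = z \<oplus> (t \<oplus> t') \<otimes> m" unfolding 2 by (simp add: algebra_simps)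
  finally have "x \<oplus> (s \<oplus> s') \<otimes> m = z \<oplus> (t \<oplus> t') \<otimes> m" .
  then show "\<exists>s t. x \<oplus> s \<otimes> m = z \<oplus> t \<otimes> m" by blast
qed

lemma congM_mult: "congM m x y \<Longrightarrow> congM m (c \<otimes> x) (c \<otimes> y)"
  unfolding congM_def
proof clarify
  fix s t
  assume "x \<oplus> s \<otimes> m = y \<oplus> t \<otimes> m"
  then have "c \<otimes> x \<oplus> (c \<otimes> s) \<otimes> m = c \<otimes> y \<oplus> (c \<otimes> t) \<otimes> m"
    by (metis sr.distrib_left sr.mult.assoc)
  then show "\<exists>s t. c \<otimes> x \<oplus> s \<otimes> m = c \<otimes> y \<oplus> t \<otimes> m" by blast
qed

lemma congM_add: "congM m x y \<Longrightarrow> congM m (c \<oplus> x) (c \<oplus> y)"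
  unfolding congM_def by (metis sr.add.assoc)

lemma congM_add_multiple: "congM m (x \<oplus> c \<otimes> m) x"
  unfolding congM_def by (rule exI[of _ "\<zero>"], rule exI[of _ c]) simp

lemma congM_remM:
  assumes "congM m x r" "r \<prec> m" shows "remM x m r"
proof -
  obtain s t where st: "x \<oplus> s \<otimes> m = r \<oplus> t \<otimes> m" using assms by (auto simp: congM_def)
  show ?thesis
  proof (cases "s \<preceq> t")
    case True
    then obtain d where "t = s \<oplus> d" by (auto simp: le_iff)
    then have "s \<otimes> m \<oplus> x = s \<otimes> m \<oplus> (d \<otimes> m \<oplus> r)" using st by (simp add: algebra_simps)
    then show ?thesis unfolding add_left_cancel using assms by (auto simp: remM_def)
  next
    case False
    then obtain d where "s = t \<oplus> d \<oplus> \<one>" using le_linear[of t s] by (auto simp: le_def less_iff)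
    then have "t \<otimes> m \<oplus> r = t \<otimes> m \<oplus> (m \<oplus> (d \<otimes> m \<oplus> x))" using st by (simp add: algebra_simps)
    then have "m \<preceq> r" unfolding add_left_cancel by simp
    then show ?thesis using assms by auto
  qed
qed

text \<open>Coprimality in the form of an explicit inverse: closure under products and the solution
  of congruences then follow without gcds inside \<open>M\<close>.\<close>

definition unitM :: "'a \<Rightarrow> 'a \<Rightarrow> bool" where
  "unitM m x \<longleftrightarrow> (\<exists>u. congM m (u \<otimes> x) \<one>)"

lemma unitM_one: "unitM m \<one>"
  unfolding unitM_def by (rule exI[of _ "\<one>"]) simp

lemma unitM_mult: "unitM m x \<Longrightarrow> unitM m y \<Longrightarrow> unitM m (x \<otimes> y)"
  unfolding unitM_def
proof clarify
  fix u v assume u: "congM m (u \<otimes> x) \<one>" and v: "congM m (v \<otimes> y) \<one>"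
  have "congM m ((v \<otimes> y) \<otimes> (u \<otimes> x)) (v \<otimes> y \<otimes> \<one>)" using u by (rule congM_mult)
  then have "congM m ((u \<otimes> v) \<otimes> (x \<otimes> y)) (v \<otimes> y)" by (simp add: algebra_simps)
  then have "congM m ((u \<otimes> v) \<otimes> (x \<otimes> y)) \<one>" using v by (rule congM_trans)
  then show "\<exists>w. congM m (w \<otimes> (x \<otimes> y)) \<one>" ..
qed

lemma unitM_solve:
  assumes "unitM (m \<oplus> \<one>) p" shows "\<exists>t. congM (m \<oplus> \<one>) (x \<oplus> t \<otimes> p) c"
proof -
  obtain u where u: "congM (m \<oplus> \<one>) (u \<otimes> p) \<one>" using assms by (auto simp: unitM_def)
  \<comment> \<open>Modulo \<open>m + 1\<close> the factor \<open>m\<close> acts as minus one, so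
    this is \<open>c - x\<close>.\<close>
  let ?k = "c \<oplus> m \<otimes> x"
  have "congM (m \<oplus> \<one>) (?k \<otimes> (u \<otimes> p)) (?k \<otimes> \<one>)" by (rule congM_mult[OF u])
  then have "congM (m \<oplus> \<one>) (x \<oplus> ?k \<otimes> (u \<otimes> p)) (x \<oplus> ?k \<otimes> \<one>)" by (rule congM_add)
  moreover have "congM (m \<oplus> \<one>) (x \<oplus> ?k \<otimes> \<one>) c"
    using congM_add_multiple[of "m \<oplus> \<one>" c x] by (simp add: algebra_simps)
  ultimately have "congM (m \<oplus> \<one>) (x \<oplus> (?k \<otimes> u) \<otimes> p) c"
    using congM_trans by (simp only: sr.mult.assoc)
  then show ?thesis ..
qed

lemma unitM_modulus:
  assumes "i \<prec> j" "j \<preceq> k" and div: "\<And>d. \<zero> \<prec> d \<Longrightarrow> d \<preceq> k \<Longrightarrow> \<exists>q. b = q \<otimes> d"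
  shows "unitM (modulus b j) (modulus b i)"
proof -
  obtain d where j: "j = i \<oplus> d \<oplus> \<one>" using assms by (auto simp: less_iff)
  have "d \<oplus> \<one> \<preceq> j" unfolding j by (simp add: le_iff) (metis add_ac)
  then obtain q where q: "b = q \<otimes> (d \<oplus> \<one>)"
    using div[of "d \<oplus> \<one>"] zero_less_Suc assms(2) le_trans by blast
  text \<open>Modulo \<open>modulus b j\<close>, the inverse of \<open>b\<close> is \<open>- (j + 1)\<close>, that of \<open>j - i\<close> is
    \<open>- q * (j + 1)\<close>, and \<open>modulus b i\<close> is \<open>- (j - i) * b\<close>; so its inverse is \<open>- u\<close>, and
    \<open>- 1\<close> is replaced by \<open>e\<close>.\<close>
  define u where "u = q \<otimes> (j \<oplus> \<one>) \<otimes> (j \<oplus> \<one>)"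
  define e where "e = b \<otimes> (j \<oplus> \<one>)"
  have m: "modulus b j = e \<oplus> \<one>" by (simp add: modulus_def e_def)
  have "modulus b i \<oplus> (d \<oplus> \<one>) \<otimes> b = e \<oplus> \<one>"
    unfolding modulus_def e_def j by (simp add: algebra_simps)
  then have *: "u \<otimes> modulus b i \<oplus> u \<otimes> ((d \<oplus> \<one>) \<otimes> b) = u \<otimes> e \<oplus> u"
    by (metis sr.distrib_left sr.mult_1_right)
  have "u \<otimes> ((d \<oplus> \<one>) \<otimes> b) = ((q \<otimes> (d \<oplus> \<one>)) \<otimes> (j \<oplus> \<one>)) \<otimes> (b \<otimes> (j \<oplus> \<one>))"
    unfolding u_def by (simp only: sr.mult_ac)
  also have "\<dots> = e \<otimes> e" unfolding e_def by (simp only: q[symmetric])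
  finally have "e \<otimes> (u \<otimes> modulus b i) \<oplus> e \<otimes> (e \<otimes> e) = e \<otimes> (u \<otimes> e) \<oplus> e \<otimes> u"
    using * by (metis sr.distrib_left)
  have "(u \<otimes> e) \<otimes> modulus b i \<oplus> (e \<otimes> e \<oplus> \<one>) \<otimes> (e \<oplus> \<one>)
      = (e \<otimes> (u \<otimes> modulus b i) \<oplus> e \<otimes> (e \<otimes> e)) \<oplus> (e \<otimes> e \<oplus> e \<oplus> \<one>)"
    by (simp add: algebra_simps)
  also have "\<dots> = \<one> \<oplus> (u \<otimes> e \<oplus> e) \<otimes> (e \<oplus> \<one>)"
    unfolding \<open>e \<otimes> (u \<otimes> modulus b i) \<oplus> _ = _\<close> by (simp add: algebra_simps)
  finally show ?thesis unfolding unitM_def congM_def m by blast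
qed

section \<open>The beta function lemma\<close>

lemma connective_simps:
  "\<not> (p \<longrightarrow> \<not> q) \<longleftrightarrow> p \<and> q" "(\<not> p \<longrightarrow> q) \<longleftrightarrow> p \<or> q" "\<not> (\<forall>x. \<not> P x) \<longleftrightarrow> (\<exists>x. P x)"
  by auto

text \<open>It separates an induction from its formula: the property \<open>C\<close> is stated and
  used in HOL, and the formula appears in a single equivalence.\<close>

lemma definable_induct:
  assumes "\<And>a. sat M (v(x := a)) p \<longleftrightarrow> C a" "C \<zero>" "\<And>a. C a \<Longrightarrow> C (a \<oplus> \<one>)"
  shows "C a"
  using induct[of v x p a] assms by simp

text \<open>A factorial would have to be defined by recursion, which presupposes coded sequences.
  The mere existence of a common multiple is first-order, and multiplying by \<open>k + 1\<close>
  gives the induction step.\<close>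

lemma common_multiple:
  "\<exists>b. B \<preceq> b \<and> (\<forall>d. \<zero> \<prec> d \<and> d \<preceq> k \<longrightarrow> (\<exists>q. b = q \<otimes> d))"
proof -
  define C where "C k \<longleftrightarrow> (\<exists>b. B \<preceq> b \<and> (\<forall>d. \<zero> \<prec> d \<and> d \<preceq> k \<longrightarrow> (\<exists>q. b = q \<otimes> d)))" for k
  have "C k"
  proof (rule definable_induct)
    show "sat M ((undefined(1 := B))(0 := k))
      (Exists 2 (And (Or (Less (Var 1) (Var 2)) (Eq (Var 1) (Var 2)))
        (All 3 (Imp (And (Less Zero (Var 3)) (Or (Less (Var 3) (Var 0)) (Eq (Var 3) (Var 0))))
          (Exists 4 (Eq (Var 2) (Times (Var 4) (Var 3)))))))) \<longleftrightarrow> C k" for k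
      unfolding C_def le_def by auto
    show "C \<zero>" unfolding C_def by (rule exI[of _ B]) auto
    show "C (k \<oplus> \<one>)" if C: "C k" for k
    proof -
      obtain b where b: "B \<preceq> b" "\<And>d. \<zero> \<prec> d \<Longrightarrow> d \<preceq> k \<Longrightarrow> \<exists>q. b = q \<otimes> d"
        using C unfolding C_def by blast
      have "b \<preceq> b \<otimes> (k \<oplus> \<one>)" by (simp add: mult_Suc add_commute)
      with b(1) have "B \<preceq> b \<otimes> (k \<oplus> \<one>)" by (rule le_trans)
      moreover have "\<exists>q. b \<otimes> (k \<oplus> \<one>) = q \<otimes> d" if d: "\<zero> \<prec> d" "d \<preceq> k \<oplus> \<one>" for d
      proof (cases "d = k \<oplus> \<one>")
        case False
        then have "d \<preceq> k" using d(2) by (simp add: le_def less_Suc)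
        then obtain q where "b = q \<otimes> d" using b(2) d(1) by blast
        then have "b \<otimes> (k \<oplus> \<one>) = (q \<otimes> (k \<oplus> \<one>)) \<otimes> d" by (simp only: sr.mult_ac)
        then show ?thesis ..
      qed blast
      ultimately show ?thesis unfolding C_def by (intro exI[of _ "b \<otimes> (k \<oplus> \<one>)"]) simp
    qed
  qed
  then show ?thesis by (simp add: C_def)
qed

text \<open>The Chinese remainder theorem, with all remainders but \<open>c\<close> read off the old
  code \<open>a\<close>, \<open>b\<close>. The new \<open>b'\<close> is divisible by every positive
  \<open>d\<close> up to \<open>k\<close>, so each new modulus is a unit modulo the later ones up to
  index \<open>k\<close>; and it is at least \<open>a + c\<close>, so every prescribed remainder is
  below its modulus.\<close>

lemma remM_extend:
  "\<exists>a' b'. (\<forall>j r. j \<prec> k \<longrightarrow> remM a (modulus b j) r \<longrightarrow> remM a' (modulus b' j) r) \<and>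
     remM a' (modulus b' k) c"
proof -
  obtain b' where b': "a \<oplus> c \<preceq> b'" "\<And>d. \<zero> \<prec> d \<Longrightarrow> d \<preceq> k \<Longrightarrow> \<exists>q. b' = q \<otimes> d"
    using common_multiple[of "a \<oplus> c" k] by (elim exE conjE) simp
  have small: "r \<prec> modulus b' j" if "r \<preceq> a \<oplus> c" for r j
  proof -
    have "b' \<preceq> b' \<otimes> (j \<oplus> \<one>)" by (simp add: mult_Suc add_commute)
    with le_trans[OF that b'(1)] have "r \<preceq> b' \<otimes> (j \<oplus> \<one>)" by (rule le_trans)
    then show ?thesis by (simp add: modulus_def less_Suc_le)
  qed
  \<comment> \<open>\<open>x\<close> solves the congruences with index below \<open>l\<close>.
    \<open>P\<close> stands for the product of their moduli, but is described only by divisibility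
    and invertibility, since such products cannot be formed before sequences are coded.\<close>
  define C where "C l \<longleftrightarrow> l \<preceq> k \<longrightarrow> (\<exists>x P.
      (\<forall>j. j \<prec> l \<longrightarrow> (\<exists>q. P = q \<otimes> modulus b' j) \<and>
        (\<forall>r. remM a (modulus b j) r \<longrightarrow> congM (modulus b' j) x r)) \<and>
      (\<forall>j. l \<preceq> j \<and> j \<preceq> k \<longrightarrow> unitM (modulus b' j) P))" for l
  have "C k"
  proof (rule definable_induct)
    \<comment> \<open>Variables 1 to 4 hold \<open>a\<close>, \<open>b\<close>, \<open>b'\<close>,
      \<open>k\<close>; variable 0 is \<open>l\<close>, 5 and 6 are \<open>x\<close> and
      \<open>P\<close>, and 7 is the index \<open>j\<close> of the moduli \<open>?m\<close> and
      \<open>?m'\<close>.\<close>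
    let ?m = "Plus (Times (Var 2) (Plus (Var 7) One)) One"
    let ?m' = "Plus (Times (Var 3) (Plus (Var 7) One)) One"
    let ?le = "\<lambda>x y. Or (Less (Var x) (Var y)) (Eq (Var x) (Var y))"
    let ?cong = "\<lambda>x y. Exists 9 (Exists 10 (Eq (Plus x (Times (Var 9) ?m')) (Plus y (Times (Var 10) ?m'))))"
    show "sat M ((undefined(1 := a, 2 := b, 3 := b', 4 := k))(0 := l))
      (Imp (?le 0 4) (Exists 5 (Exists 6 (And
        (All 7 (Imp (Less (Var 7) (Var 0)) (And (Exists 8 (Eq (Var 6) (Times (Var 8) ?m')))
          (All 8 (Imp (And (Exists 9 (Eq (Var 1) (Plus (Times (Var 9) ?m) (Var 8)))) (Less (Var 8) ?m))
            (?cong (Var 5) (Var 8)))))))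
        (All 7 (Imp (And (?le 0 7) (?le 7 4)) (Exists 8 (?cong (Times (Var 8) (Var 6)) One)))))))) \<longleftrightarrow> C l" for l
      unfolding C_def le_def remM_def congM_def unitM_def modulus_def sat.simps connective_simps by simp
    show "C \<zero>" unfolding C_def
      by (intro impI exI[of _ "\<zero>"] exI[of _ "\<one>"]) (simp add: unitM_one)
    show "C (l \<oplus> \<one>)" if C: "C l" for l
      unfolding C_def
    proof
      assume "l \<oplus> \<one> \<preceq> k"
      then have l: "l \<prec> k" by (simp add: Suc_le_iff)
      then have "l \<preceq> k" by (simp add: le_def)
      then obtain x P where
        P: "\<And>j. j \<prec> l \<Longrightarrow> \<exists>q. P = q \<otimes> modulus b' j" and
        x: "\<And>j r. j \<prec> l \<Longrightarrow> remM a (modulus b j) r \<Longrightarrow> congM (modulus b' j) x r" and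
        unit: "\<And>j. l \<preceq> j \<Longrightarrow> j \<preceq> k \<Longrightarrow> unitM (modulus b' j) P"
        using C unfolding C_def by blast
      obtain s where s: "remM a (modulus b l) s" unfolding modulus_def using remM_exists by blast
      have "unitM (modulus b' l) P" using unit[of l] l by (simp add: le_def)
      then obtain t where t: "congM (modulus b' l) (x \<oplus> t \<otimes> P) s"
        unfolding modulus_def using unitM_solve[of _ P x s] by blast
      \<comment> \<open>Adding a multiple of \<open>P\<close> changes nothing modulo the earlier
        moduli, and \<open>t\<close> was chosen to obtain the remainder \<open>s\<close> at index
        \<open>l\<close>.\<close>
      let ?x = "x \<oplus> t \<otimes> P" and ?P = "P \<otimes> modulus b' l"
      have "(\<exists>q. ?P = q \<otimes> modulus b' j) \<and>
          (\<forall>r. remM a (modulus b j) r \<longrightarrow> congM (modulus b' j) ?x r)" if "j \<prec> l \<oplus> \<one>" for j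
      proof (cases "j = l")
        case True
        then show ?thesis using t s remM_fun by blast
      next
        case False
        then have j: "j \<prec> l" using that by (simp add: less_Suc)
        then obtain q where q: "P = q \<otimes> modulus b' j" using P by blast
        then have "?P = (q \<otimes> modulus b' l) \<otimes> modulus b' j" by (simp only: sr.mult_ac)
        moreover have "congM (modulus b' j) ?x x"
          using congM_add_multiple[of "modulus b' j" x "t \<otimes> q"] q by (simp only: sr.mult.assoc)
        ultimately show ?thesis using congM_trans[OF _ x[OF j]] by blast
      qed
      moreover have "unitM (modulus b' j) ?P" if j: "l \<oplus> \<one> \<preceq> j" "j \<preceq> k" for j
      proof (rule unitM_mult)
        have lj: "l \<prec> j" using j by (simp add: Suc_le_iff)
        then show "unitM (modulus b' j) P" using j by (intro unit) (simp_all add: le_def)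
        show "unitM (modulus b' j) (modulus b' l)" using lj j(2) b'(2) by (rule unitM_modulus)
      qed
      ultimately show "\<exists>x P. (\<forall>j. j \<prec> l \<oplus> \<one> \<longrightarrow> (\<exists>q. P = q \<otimes> modulus b' j) \<and>
          (\<forall>r. remM a (modulus b j) r \<longrightarrow> congM (modulus b' j) x r)) \<and>
          (\<forall>j. l \<oplus> \<one> \<preceq> j \<and> j \<preceq> k \<longrightarrow> unitM (modulus b' j) P)"
        by (intro exI[of _ ?x] exI[of _ ?P]) simp
    qed
  qed
  then obtain x P where
    P: "\<And>j. j \<prec> k \<Longrightarrow> \<exists>q. P = q \<otimes> modulus b' j" and
    x: "\<And>j r. j \<prec> k \<Longrightarrow> remM a (modulus b j) r \<Longrightarrow> congM (modulus b' j) x r" and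
    unit: "unitM (modulus b' k) P"
    unfolding C_def using sr.order_refl by blast
  obtain t where t: "congM (modulus b' k) (x \<oplus> t \<otimes> P) c"
    using unit unitM_solve[of _ P x c] unfolding modulus_def by blast
  have "remM (x \<oplus> t \<otimes> P) (modulus b' j) r" if j: "j \<prec> k" and r: "remM a (modulus b j) r" for j r
  proof (rule congM_remM)
    obtain q where "P = q \<otimes> modulus b' j" using P j by blast
    then have "congM (modulus b' j) (x \<oplus> t \<otimes> P) x"
      using congM_add_multiple[of "modulus b' j" x "t \<otimes> q"] by (simp only: sr.mult.assoc)
    then show "congM (modulus b' j) (x \<oplus> t \<otimes> P) r" using x[OF j r] by (rule congM_trans)
    have "r \<preceq> a" using r by (auto simp: remM_def le_iff intro: sr.add.commute)
    then show "r \<prec> modulus b' j" by (rule small[OF le_trans[OF _ le_self_add]])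
  qed
  moreover have "remM (x \<oplus> t \<otimes> P) (modulus b' k) c"
    using t small[of c k] by (intro congM_remM) (auto simp: add_commute)
  ultimately show ?thesis by blast
qed

text \<open>Sequences of nonstandard length are built by appending one entry at a time, by induction
  in \<open>M\<close>; this is the step.\<close>

lemma betaM_extend:
  "\<exists>w'. (\<forall>j r. j \<prec> k \<longrightarrow> betaM w j r \<longrightarrow> betaM w' j r) \<and> betaM w' k c"
proof (cases "\<exists>a b. pairM a b w")
  case True
  then obtain a b where w: "pairM a b w" by blast
  obtain a' b' where ab: "\<And>j r. j \<prec> k \<Longrightarrow> remM a (modulus b j) r \<Longrightarrow> remM a' (modulus b' j) r"
    "remM a' (modulus b' k) c" using remM_extend[of k a b c] by blast
  obtain w' where "pairM a' b' w'" using pairM_exists by blast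
  then show ?thesis using ab w pairM_inj unfolding betaM_def by metis
next
  \<comment> \<open>An element that codes no pair has no entries, so nothing has to be
    preserved.\<close>
  case False
  obtain a' b' where "remM a' (modulus b' k) c" using remM_extend by blast
  moreover obtain w' where "pairM a' b' w'" using pairM_exists by blast
  ultimately show ?thesis using False unfolding betaM_def by blast
qed

section \<open>Coded tuples and sequences of tuples\<close>

fun tupleM :: "'a \<Rightarrow> 'a list \<Rightarrow> bool" where
  "tupleM z [] \<longleftrightarrow> True"
| "tupleM z [a] \<longleftrightarrow> z = a"
| "tupleM z (a # as) \<longleftrightarrow> (\<exists>t. pairM a t z \<and> tupleM t as)"

lemma tupleM_exists: "\<exists>z. tupleM z as"
proof (induction as rule: induct_list012)
  case (3 a b as)
  then show ?case using pairM_exists by simp blast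
qed auto

lemma tupleM_fun: "tupleM z as \<Longrightarrow> tupleM z' as \<Longrightarrow> as \<noteq> [] \<Longrightarrow> z = z'"
proof (induction z as arbitrary: z' rule: tupleM.induct)
  case (3 z a b as)
  then show ?case using pairM_fun by (metis list.distinct(1) tupleM.simps(3))
qed auto

text \<open>The length must be given: every \<open>z\<close> codes the one-element tuple
  \<open>[z]\<close>, also when it codes a longer one.\<close>

lemma tupleM_inj: "tupleM z as \<Longrightarrow> tupleM z bs \<Longrightarrow> length as = length bs \<Longrightarrow> as = bs"
proof (induction z as arbitrary: bs rule: tupleM.induct)
  case (2 z a)
  then show ?case by (cases bs) auto
next
  case (3 z a b as)
  then obtain c d cs where bs: "bs = c # d # cs"
    by (metis length_Suc_conv list.size(4) add.right_neutral add_Suc_right One_nat_def)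
  then obtain t u where t: "pairM a t z" "tupleM t (b # as)" "pairM c u z" "tupleM u (d # cs)"
    using 3 by auto
  then have "a = c" "t = u" using pairM_inj by blast+
  moreover have "b # as = d # cs"
    using t \<open>t = u\<close> "3.prems"(3) bs by (intro "3.IH") auto
  ultimately show ?case using bs by simp
qed auto

definition entryM :: "'a \<Rightarrow> 'a \<Rightarrow> 'a list \<Rightarrow> bool" where
  "entryM w i as \<longleftrightarrow> (\<exists>c. betaM w i c \<and> tupleM c as)"

lemma entryM_fun: "entryM w i as \<Longrightarrow> entryM w i bs \<Longrightarrow> length as = length bs \<Longrightarrow> as = bs"
  unfolding entryM_def using betaM_fun tupleM_inj by blast

lemma entryM_extend:
  "\<exists>w'. (\<forall>j bs. j \<prec> k \<longrightarrow> entryM w j bs \<longrightarrow> entryM w' j bs) \<and> entryM w' k as"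
  using tupleM_exists[of as] betaM_extend[of k w] unfolding entryM_def by metis

end

section \<open>Programs in models of PA\<close>

lemma upd_Nil [simp]: "upd v [] as = v"
  by (simp add: upd_def)

lemma upd_Cons [simp]: "upd v (x # xs) (a # as) = (upd v xs as)(x := a)"
  by (auto simp: upd_def)

lemma upd_notin [simp]: "y \<notin> set xs \<Longrightarrow> upd v xs as y = v y"
proof -
  assume "y \<notin> set xs"
  then have "map_of (zip xs as) y = None" by (auto simp: map_of_eq_None_iff dest: set_zip_leftD)
  then show ?thesis by (simp add: upd_def)
qed

lemma map_upd [simp]: "distinct xs \<Longrightarrow> length as = length xs \<Longrightarrow> map (upd v xs as) xs = as"
proof (induction xs arbitrary: as)
  case (Cons x xs)
  then obtain a bs where as: "as = a # bs" by (cases as) auto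
  have "map ((upd v xs bs)(x := a)) xs = map (upd v xs bs) xs"
    using Cons.prems by (intro map_cong) auto
  then show ?case using Cons.IH[of bs] Cons.prems as by (simp del: fun_upd_apply) simp
qed simp

lemma upd_map: "upd v xs (map w xs) y = (if y \<in> set xs then w y else v y)"
  by (induction xs) auto

lemma upd_in_cong: "y \<in> set xs \<Longrightarrow> length as = length xs \<Longrightarrow> upd v xs as y = upd w xs as y"
  by (induction xs as rule: list_induct2') auto

lemma upd_upd: "length bs = length xs \<Longrightarrow> upd (upd v xs as) xs bs = upd v xs bs"
proof
  fix y assume "length bs = length xs"
  then show "upd (upd v xs as) xs bs y = upd v xs bs y"
    by (cases "y \<in> set xs") (auto intro: upd_in_cong)
qed

lemma map_upd_disjoint: "set ys \<inter> set xs = {} \<Longrightarrow> map (upd v xs as) ys = map v ys"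
  by (simp add: disjoint_iff)

lemma upd_fun_upd: "x \<notin> set xs \<Longrightarrow> upd (v(x := a)) xs as = (upd v xs as)(x := a)"
  by (rule ext) (auto simp: upd_def dest!: map_of_SomeD set_zip_leftD split: option.splits)

lemma sat_And: "sat M v (And p q) \<longleftrightarrow> sat M v p \<and> sat M v q"
  by simp

lemma sat_Exists: "sat M v (Exists x p) \<longleftrightarrow> (\<exists>a. sat M (v(x := a)) p)"
  by simp

lemma sat_Exs:
  "distinct xs \<Longrightarrow> sat M v (Exs xs p) \<longleftrightarrow> (\<exists>as. length as = length xs \<and> sat M (upd v xs as) p)"
proof (induction xs arbitrary: v)
  case Nil
  then show ?case by (simp add: Exs_def)
next
  case (Cons x xs)
  have "sat M v (Exs (x # xs) p) \<longleftrightarrow> (\<exists>a. sat M (v(x := a)) (Exs xs p))"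
    by (simp add: Exs_def)
  also have "\<dots> \<longleftrightarrow> (\<exists>a as. length as = length xs \<and> sat M (upd v (x # xs) (a # as)) p)"
    using Cons by (simp add: upd_fun_upd)
  also have "\<dots> \<longleftrightarrow> (\<exists>as. length as = length (x # xs) \<and> sat M (upd v (x # xs) as) p)"
    by (metis length_Suc_conv length_Cons)
  finally show ?case .
qed

lemma val_at_vars:
  assumes "length ys = length xs" "tvars t \<subseteq> set xs"
  shows "val M v (tsubst t (at_vars xs ys)) = val M (upd w xs (map v ys)) t"
proof -
  have "val M v (at_vars xs ys x) = upd w xs (map v ys) x" if "x \<in> set xs" for x
    using assms(1) that unfolding at_vars_def
    by (induction ys xs rule: list_induct2) auto
  then show ?thesis using assms(2) by (auto simp: val_tsubst intro!: val_cong)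
qed

lemma sat_at_vars:
  assumes "length ys = length xs"
  shows "sat M v (subst p (at_vars xs ys)) = sat M (upd v xs (map v ys)) p"
proof -
  have "val M v (at_vars xs ys x) = upd v xs (map v ys) x" for x
    using assms unfolding at_vars_def
    by (induction ys xs rule: list_induct2) auto
  then show ?thesis by (simp add: sat_subst)
qed

lemma sat_upd_cong:
  assumes "fvars p \<subseteq> set xs" "length as = length xs"
  shows "sat M (upd v xs as) p = sat M (upd w xs as) p"
  using assms by (intro sat_cong upd_in_cong) auto

lemma sat_foldr_And: "sat M v (foldr And ps (Eq Zero Zero)) \<longleftrightarrow> (\<forall>p\<in>set ps. sat M v p)"
  by (induction ps) auto

section \<open>Meaning of the coding formulas\<close>

context pa_model begin

lemma sat_pair_fm [simp]: "sat M v (pair_fm x y z) \<longleftrightarrow> pairM (val M v x) (val M v y) (val M v z)"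
proof -
  define u where "u = new_var (tvars x \<union> tvars y \<union> tvars z)"
  have "u \<notin> tvars x \<union> tvars y \<union> tvars z" unfolding u_def by (intro new_var_fresh) auto
  then show ?thesis
    by (simp add: pair_fm_def Let_def pairM_def val_upd_fresh connective_simps flip: u_def) blast
qed

lemma sat_tuple_fm [simp]:
  "sat M v (tuple_fm z us) \<longleftrightarrow> tupleM (val M v z) (map v us)"
proof (induction z us arbitrary: v rule: tuple_fm.induct)
  case (3 z u u' us)
  define t where "t = new_var (tvars z \<union> set (u # u' # us))"
  have t: "t \<notin> tvars z \<union> set (u # u' # us)" unfolding t_def by (intro new_var_fresh) auto
  have "map (v(t := a)) (u' # us) = map v (u' # us)" for a using t by auto
  then have "sat M v (Exists t (And (pair_fm (Var u) (Var t) z) (tuple_fm (Var t) (u' # us))))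
     \<longleftrightarrow> tupleM (val M v z) (map v (u # u' # us))"
    using t "3.IH"[OF t_def] by (simp add: val_upd_fresh)
  then show ?case by (simp only: tuple_fm.simps Let_def flip: t_def)
qed auto

lemma sat_beta_fm [simp]:
  "sat M v (beta_fm x i r) \<longleftrightarrow> betaM (val M v x) (val M v i) (val M v r)"
proof -
  define a where "a = new_var (tvars x \<union> tvars i \<union> tvars r)"
  have "a + k \<notin> tvars x \<union> tvars i \<union> tvars r" for k unfolding a_def by (intro new_var_notin) auto
  from this[of 0] this[of 1] this[of 2] show ?thesis
    by (simp add: beta_fm_def Let_def Exs_def betaM_def remM_def modulus_def val_upd_fresh connective_simps
        flip: a_def) blast
qed

lemma sat_entry_fm [simp]:
  "sat M v (entry_fm w i us) \<longleftrightarrow> entryM (val M v w) (val M v i) (map v us)"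
proof -
  define c where "c = new_var (tvars w \<union> tvars i \<union> set us)"
  have c: "c \<notin> tvars w \<union> tvars i \<union> set us" unfolding c_def by (intro new_var_fresh) auto
  then have "map (v(c := a)) us = map v us" for a by auto
  then show ?thesis using c
    by (simp add: entry_fm_def Let_def entryM_def val_upd_fresh connective_simps flip: c_def)
qed

section \<open>Coded runs of an iterated relation\<close>

definition runM :: "nat \<Rightarrow> ('a list \<Rightarrow> 'a list \<Rightarrow> bool) \<Rightarrow> 'a \<Rightarrow> 'a \<Rightarrow> bool" where
  "runM n R w i \<longleftrightarrow> (\<forall>j. j \<prec> i \<longrightarrow> (\<exists>ps qs. length ps = n \<and> length qs = n \<and>
     entryM w j ps \<and> entryM w (j \<oplus> \<one>) qs \<and> R ps qs))"

text \<open>\<open>runM\<close> is kept apart from the two end points, so that one code can be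
  reused for a shorter run or a weaker step relation.\<close>

definition seqM :: "nat \<Rightarrow> ('a list \<Rightarrow> 'a list \<Rightarrow> bool) \<Rightarrow> 'a \<Rightarrow> 'a list \<Rightarrow> 'a list \<Rightarrow> bool" where
  "seqM n R i as bs \<longleftrightarrow> (\<exists>w. entryM w \<zero> as \<and> runM n R w i \<and> entryM w i bs)"

text \<open>The assumption on \<open>step\<close> ranges over all variable lists of the right length
  because the lists \<open>ps\<close> and \<open>qs\<close> are chosen inside the formula.\<close>

lemma sat_seq_fm:
  assumes step: "\<And>u ps qs. length ps = length ys \<Longrightarrow> length qs = length ys \<Longrightarrow>
      sat M u (step ps qs) \<longleftrightarrow> R (map u ps) (map u qs)"
  shows "sat M v (seq_fm step i ys zs) \<longleftrightarrow> seqM (length ys) R (v i) (map v ys) (map v zs)"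
proof -
  let ?n = "length ys"
  define V where "V = insert i (set ys \<union> set zs)"
  define w where "w = new_var V"
  define j where "j = Suc w"
  define ps where "ps = new_vars ?n (insert j V)"
  define qs where "qs = new_vars ?n (insert j V \<union> set ps)"
  have "w + k \<notin> V" for k unfolding w_def by (intro new_var_notin) (simp add: V_def)
  from this[of 0] this[of 1] have wj: "w \<notin> V" "j \<notin> V" by (simp_all add: j_def)
  have ps: "set ps \<inter> insert j V = {}" unfolding ps_def by (intro new_vars_fresh) (simp add: V_def)
  have qs: "set qs \<inter> (insert j V \<union> set ps) = {}" unfolding qs_def
    by (intro new_vars_fresh) (simp add: V_def)
  \<comment> \<open>The sets avoided by \<open>ps\<close> and \<open>qs\<close> do not contain
    \<open>w\<close> itself. But new variables exceed all elements of the avoided set, and this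
    contains \<open>j\<close>, the successor of \<open>w\<close>.\<close>
  have "new_var (insert j V) > w" "new_var (insert j V \<union> set ps) > w"
    by (auto simp: new_var_def V_def j_def less_Suc_eq_le intro!: Max_ge_iff[THEN iffD2])
  then have wpq: "w \<notin> set ps \<union> set qs" by (auto simp: ps_def qs_def new_vars_def)
  have len: "length ps = ?n" "length qs = ?n" and dist: "distinct (ps @ qs)"
    using qs by (auto simp: ps_def qs_def)
  have inner: "sat M u (Exs (ps @ qs) (And (entry_fm (Var w) (Var j) ps)
        (And (entry_fm (Var w) (Plus (Var j) One) qs) (step ps qs)))) \<longleftrightarrow>
      (\<exists>as bs. length as = ?n \<and> length bs = ?n \<and> entryM (u w) (u j) as \<and>
        entryM (u w) (u j \<oplus> \<one>) bs \<and> R as bs)" for u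
  proof -
    have w: "upd u (ps @ qs) cs w = u w" and j: "upd u (ps @ qs) cs j = u j" for cs
      using wpq ps qs by auto
    have "map (upd u (ps @ qs) cs) ps = take ?n cs \<and> map (upd u (ps @ qs) cs) qs = drop ?n cs"
      if "length cs = ?n + ?n" for cs
    proof -
      have "map (upd u (ps @ qs) cs) (ps @ qs) = cs" using dist len that by (intro map_upd) auto
      then show ?thesis using len by (metis append_eq_conv_conj length_map map_append)
    qed
    then have "sat M u (Exs (ps @ qs) (And (entry_fm (Var w) (Var j) ps)
        (And (entry_fm (Var w) (Plus (Var j) One) qs) (step ps qs)))) \<longleftrightarrow>
        (\<exists>cs. length cs = ?n + ?n \<and> entryM (u w) (u j) (take ?n cs) \<and>
        entryM (u w) (u j \<oplus> \<one>) (drop ?n cs) \<and> R (take ?n cs) (drop ?n cs))"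
      unfolding sat_Exs[OF dist] sat_And sat_entry_fm val.simps w j
      using len by (auto simp: step)
    also have "\<dots> \<longleftrightarrow> (\<exists>as bs. length as = ?n \<and> length bs = ?n \<and> entryM (u w) (u j) as \<and>
        entryM (u w) (u j \<oplus> \<one>) bs \<and> R as bs)" (is "?L \<longleftrightarrow> ?R")
    proof
      assume ?R
      then obtain as bs where "length as = ?n" "length bs = ?n" "entryM (u w) (u j) as"
        "entryM (u w) (u j \<oplus> \<one>) bs" "R as bs" by blast
      then show ?L by (intro exI[of _ "as @ bs"]) simp
    next
      assume ?L
      then obtain cs where "length cs = ?n + ?n" "entryM (u w) (u j) (take ?n cs)"
        "entryM (u w) (u j \<oplus> \<one>) (drop ?n cs)" "R (take ?n cs) (drop ?n cs)" by blast
      then show ?R by (intro exI[of _ "take ?n cs"] exI[of _ "drop ?n cs"]) simp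
    qed
    finally show ?thesis .
  qed
  have eqs: "map (v(w := a)) ys = map v ys" "map (v(w := a)) zs = map v zs" "(v(w := a)) i = v i" for a
    using wj by (auto simp: V_def)
  have ij: "i \<noteq> j" "i \<noteq> w" "j \<noteq> w" using wj by (auto simp: V_def j_def)
  have "sat M v (seq_fm step i ys zs) \<longleftrightarrow> sat M v (Exists w
           (And (entry_fm (Var w) Zero ys)
             (And (All j (Imp (Less (Var j) (Var i))
                     (Exs (ps @ qs)
                       (And (entry_fm (Var w) (Var j) ps)
                         (And (entry_fm (Var w) (Plus (Var j) One) qs) (step ps qs))))))
               (entry_fm (Var w) (Var i) zs))))"
    unfolding seq_fm_def Let_def V_def[symmetric] w_def[symmetric] j_def[symmetric]
      ps_def[symmetric] qs_def[symmetric] ..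
  also have "\<dots> \<longleftrightarrow> seqM ?n R (v i) (map v ys) (map v zs)"
    unfolding sat_Exists sat_And sat_entry_fm eqs seqM_def runM_def sat.simps(4,5) inner sat.simps(2)
      val.simps using ij by simp
  finally show ?thesis .
qed

lemma entryM_same_code:
  assumes "betaM w j c" "betaM w' j c" "entryM w j ps" "entryM w' j ps'" "length ps = length ps'"
  shows "ps = ps'"
  using assms unfolding entryM_def by (metis betaM_fun tupleM_inj)

text \<open>The induction compares the single elements that code the entries. Its formula thus needs
  only \<open>beta_fm\<close> and not \<open>R\<close>, which is an arbitrary HOL predicate.\<close>

lemma run_agree:
  assumes det: "\<And>ps qs qs'. length ps = n \<Longrightarrow> length qs = n \<Longrightarrow> length qs' = n \<Longrightarrow> R ps qs \<Longrightarrow> R ps qs' \<Longrightarrow> qs = qs'"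
    and as: "length as = n" "as \<noteq> []" "entryM w \<zero> as" "entryM w' \<zero> as"
    and run: "runM n R w i" "runM n R w' i'"
    and j: "j \<preceq> i" "j \<preceq> i'"
  shows "\<exists>c. betaM w j c \<and> betaM w' j c"
proof -
  define C where "C j \<longleftrightarrow> (j \<preceq> i \<and> j \<preceq> i' \<longrightarrow> (\<exists>c. betaM w j c \<and> betaM w' j c))" for j
  have "C j"
  proof (rule definable_induct)
    let ?le = "\<lambda>x y. Or (Less (Var x) (Var y)) (Eq (Var x) (Var y))"
    show "sat M ((undefined(1 := w, 2 := w', 3 := i, 4 := i'))(0 := j))
      (Imp (And (?le 0 3) (?le 0 4))
        (Exists 5 (And (beta_fm (Var 1) (Var 0) (Var 5)) (beta_fm (Var 2) (Var 0) (Var 5))))) \<longleftrightarrow> C j" for j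
      unfolding C_def le_def sat.simps connective_simps by simp
    show "C \<zero>" using as tupleM_fun unfolding C_def entryM_def by metis
    show "C (j \<oplus> \<one>)" if C: "C j" for j
      unfolding C_def
    proof (intro impI)
      assume "j \<oplus> \<one> \<preceq> i \<and> j \<oplus> \<one> \<preceq> i'"
      then have j: "j \<prec> i" "j \<prec> i'" by (simp_all add: Suc_le_iff)
      then obtain c where c: "betaM w j c" "betaM w' j c" using C unfolding C_def by (auto simp: le_def)
      obtain ps qs where w: "length ps = n" "length qs = n" "entryM w j ps"
        "entryM w (j \<oplus> \<one>) qs" "R ps qs" using run(1) j(1) unfolding runM_def by blast
      obtain ps' qs' where w': "length ps' = n" "length qs' = n" "entryM w' j ps'"
        "entryM w' (j \<oplus> \<one>) qs'" "R ps' qs'" using run(2) j(2) unfolding runM_def by blast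
      have "ps = ps'" using entryM_same_code[OF c w(3) w'(3)] w w' by simp
      then have "qs = qs'" using det w w' by metis
      \<comment> \<open>The empty tuple is coded by every element; only for positive
        \<open>n\<close> does equality of the tuples give equality of their codes.\<close>
      moreover have "n \<noteq> 0" using as by auto
      ultimately show "\<exists>c. betaM w (j \<oplus> \<one>) c \<and> betaM w' (j \<oplus> \<one>) c"
        using w w' tupleM_fun unfolding entryM_def by (metis list.size(3))
    qed
  qed
  then show ?thesis using j by (simp add: C_def)
qed

section \<open>The input-output relation defined by \<open>alpha_fm\<close>\<close>

definition asg :: "nat list \<Rightarrow> 'a list \<Rightarrow> nat \<Rightarrow> 'a" where
  "asg xs as = upd (\<lambda>_. \<zero>) xs as"

text \<open>A relation on vectors of values: the variable names chosen in the formulas disappear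
  from later arguments. Zero outside \<open>xs\<close>, the default of \<open>asg\<close>, makes
  tests and expressions depend on the vector alone.\<close>

primrec alphaM :: "nat list \<Rightarrow> prog \<Rightarrow> 'a list \<Rightarrow> 'a list \<Rightarrow> bool" where
  "alphaM xs (Assign x e) as bs \<longleftrightarrow> bs = map ((asg xs as)(x := val M (asg xs as) e)) xs"
| "alphaM xs (Seq S1 S2) as bs \<longleftrightarrow>
     (\<exists>cs. length cs = length xs \<and> alphaM xs S1 as cs \<and> alphaM xs S2 cs bs)"
| "alphaM xs (Cond b S1 S2) as bs \<longleftrightarrow>
     (if sat M (asg xs as) (bfm b) then alphaM xs S1 as bs else alphaM xs S2 as bs)"
| "alphaM xs (While b S) as bs \<longleftrightarrow>
     (\<exists>i. seqM (length xs) (\<lambda>ps qs. sat M (asg xs ps) (bfm b) \<and> alphaM xs S ps qs) i as bs) \<and>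
     \<not> sat M (asg xs bs) (bfm b)"

lemma sat_asg:
  assumes "fvars p \<subseteq> set xs" "length as = length xs"
  shows "sat M (upd v xs as) p \<longleftrightarrow> sat M (asg xs as) p"
  unfolding asg_def using assms by (rule sat_upd_cong)

lemma sat_asg_map:
  assumes "fvars p \<subseteq> set xs"
  shows "sat M (asg xs (map v xs)) p \<longleftrightarrow> sat M v p"
  unfolding asg_def using assms by (intro sat_cong) (auto simp: upd_map)

lemma sat_bfm_at:
  assumes "fvars p \<subseteq> set xs" "length ys = length xs"
  shows "sat M v (subst p (at_vars xs ys)) \<longleftrightarrow> sat M (asg xs (map v ys)) p"
  using assms by (simp add: sat_at_vars sat_asg)

lemma asg_nth: "distinct xs \<Longrightarrow> length as = length xs \<Longrightarrow> i < length xs \<Longrightarrow> asg xs as (xs ! i) = as ! i"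
  unfolding asg_def by (metis map_upd nth_map)

lemma sat_alpha_fm:
  assumes "distinct xs" "pvars S \<subseteq> set xs" "length ys = length xs" "length zs = length xs"
  shows "sat M v (alpha_fm xs S ys zs) \<longleftrightarrow> alphaM xs S (map v ys) (map v zs)"
  using assms(2-)
proof (induction S arbitrary: v ys zs)
  case (Assign x e)
  have e: "val M v (tsubst e (at_vars xs ys)) = val M (asg xs (map v ys)) e"
    unfolding asg_def using Assign by (intro val_at_vars) auto
  have z: "set (zip xs (zip ys zs)) = {(xs ! i, ys ! i, zs ! i) | i. i < length xs}"
    using Assign by (auto simp: set_zip)
  have "sat M v (alpha_fm xs (Assign x e) ys zs) \<longleftrightarrow> (\<forall>(x', y, z) \<in> set (zip xs (zip ys zs)).
      v z = (if x' = x then val M (asg xs (map v ys)) e else v y))"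
    by (auto simp: sat_foldr_And e split: if_splits)
  also have "\<dots> \<longleftrightarrow> (\<forall>i < length xs. v (zs ! i) =
      (if xs ! i = x then val M (asg xs (map v ys)) e else v (ys ! i)))"
    unfolding z by blast
  also have "\<dots> \<longleftrightarrow> alphaM xs (Assign x e) (map v ys) (map v zs)"
    using Assign assms(1) by (auto simp: list_eq_iff_nth_eq asg_nth)
  finally show ?case .
next
  case (Seq S1 S2)
  define us where "us = new_vars (length xs) (set ys \<union> set zs)"
  have us: "length us = length xs" "distinct us" "set us \<inter> (set ys \<union> set zs) = {}"
    unfolding us_def by (simp, simp, intro new_vars_fresh) simp
  have *: "map (upd v us cs) ys = map v ys" "map (upd v us cs) zs = map v zs" for cs
    using us(3) by (intro map_upd_disjoint, blast)+
  have "sat M v (Exs us (And (alpha_fm xs S1 ys us) (alpha_fm xs S2 us zs))) \<longleftrightarrow>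
      alphaM xs (Seq S1 S2) (map v ys) (map v zs)"
    unfolding sat_Exs[OF us(2)] sat_And using Seq us by (auto simp: * )
  then show ?case by (simp only: alpha_fm.simps Let_def flip: us_def)
next
  case (Cond b S1 S2)
  then have "fvars (bfm b) \<subseteq> set xs" by simp
  then show ?case using Cond by (simp add: sat_bfm_at)
next
  case (While b S)
  then have b: "fvars (bfm b) \<subseteq> set xs" by simp
  define i where "i = new_var (set ys \<union> set zs)"
  have i: "i \<notin> set ys \<union> set zs" unfolding i_def by (intro new_var_fresh) simp
  then have *: "map (v(i := a)) ys = map v ys" "map (v(i := a)) zs = map v zs" for a by auto
  have "sat M u (seq_fm (\<lambda>ps qs. And (subst (bfm b) (at_vars xs ps)) (alpha_fm xs S ps qs)) i ys zs)
      \<longleftrightarrow> seqM (length xs) (\<lambda>ps qs. sat M (asg xs ps) (bfm b) \<and> alphaM xs S ps qs)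
        (u i) (map u ys) (map u zs)" for u
    unfolding While.prems(2)[symmetric] using While b by (intro sat_seq_fm) (simp add: sat_bfm_at)
  then have "sat M v (And (Exists i (seq_fm (\<lambda>ps qs. And (subst (bfm b) (at_vars xs ps)) (alpha_fm xs S ps qs)) i ys zs))
             (Neg (subst (bfm b) (at_vars xs zs)))) \<longleftrightarrow> alphaM xs (While b S) (map v ys) (map v zs)"
    unfolding sat_And sat_Exists using While b by (simp add: * sat_bfm_at)
  then show ?case by (simp only: alpha_fm.simps Let_def flip: i_def)
qed

section \<open>Determinism and agreement with the X-semantics\<close>

lemma runM_mono: "runM n R w i \<Longrightarrow> (\<And>ps qs. R ps qs \<Longrightarrow> R' ps qs) \<Longrightarrow> j \<preceq> i \<Longrightarrow> runM n R' w j"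
  unfolding runM_def by (meson sr.less_le_trans)

lemma seq_unique:
  assumes det: "\<And>ps qs qs'. length ps = n \<Longrightarrow> length qs = n \<Longrightarrow> length qs' = n \<Longrightarrow> R ps qs \<Longrightarrow> R ps qs' \<Longrightarrow> qs = qs'"
    and "length as = n" "as \<noteq> []" "entryM w \<zero> as" "entryM w' \<zero> as"
    and "runM n R w i" "runM n R w' i'" "j \<preceq> i" "j \<preceq> i'"
    and "entryM w j bs" "entryM w' j cs" "length bs = length cs"
  shows "bs = cs"
proof -
  obtain c where "betaM w j c" "betaM w' j c"
    using run_agree[of n R as w w' i i' j] assms by blast
  then show ?thesis using assms by (blast intro: entryM_same_code)
qed

text \<open>Two runs of a loop agree as long as both last. If one were shorter, the test would fail
  in its last entry, whereas the longer run passes the test at that stage.\<close>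

lemma alphaM_fun:
  assumes "distinct xs" "xs \<noteq> []"
  shows "length as = length xs \<Longrightarrow> length bs = length xs \<Longrightarrow> length cs = length xs \<Longrightarrow>
    alphaM xs S as bs \<Longrightarrow> alphaM xs S as cs \<Longrightarrow> bs = cs"
proof (induction S arbitrary: as bs cs)
  case (Seq S1 S2)
  then show ?case by (metis alphaM.simps(2))
next
  case (Cond b S1 S2)
  then show ?case by (auto split: if_splits)
next
  case (While b S)
  let ?n = "length xs"
  let ?B = "\<lambda>as. sat M (asg xs as) (bfm b)"
  let ?R = "\<lambda>ps qs. ?B ps \<and> alphaM xs S ps qs"
  obtain i w where w: "entryM w \<zero> as" "runM ?n ?R w i" "entryM w i bs" "\<not> ?B bs"
    using While.prems(4) by (auto simp: seqM_def)
  obtain i' w' where w': "entryM w' \<zero> as" "runM ?n ?R w' i'" "entryM w' i' cs" "\<not> ?B cs"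
    using While.prems(5) by (auto simp: seqM_def)
  have det: "qs = qs'" if "length ps = ?n" "length qs = ?n" "length qs' = ?n" "?R ps qs" "?R ps qs'" for ps qs qs'
    using While.IH that by blast
  have as: "as \<noteq> []" using While.prems(1) assms(2) by auto
  have no: "\<not> i \<prec> i'" if h: "entryM w \<zero> as" "runM ?n ?R w i" "entryM w i bs" "\<not> ?B bs" "length bs = ?n"
    "entryM w' \<zero> as" "runM ?n ?R w' i'" for w w' i i' bs
  proof
    assume i: "i \<prec> i'"
    then obtain ps where ps: "length ps = ?n" "entryM w' i ps" "?B ps"
      using h(7) unfolding runM_def by blast
    have ii: "i \<preceq> i" "i \<preceq> i'" using i by (simp_all add: le_def)
    have "length bs = length ps" using h(5) ps(1) by simp
    with det While.prems(1) as h(1,6,2,7) ii h(3) ps(2) have "bs = ps" by (rule seq_unique)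
    then show False using h(4) ps(3) by simp
  qed
  have "\<not> i \<prec> i'" "\<not> i' \<prec> i"
    using no[OF w While.prems(2) w'(1,2)] no[OF w' While.prems(3) w(1,2)] .
  then have "i = i'" using le_linear by (metis le_def)
  have ii: "i \<preceq> i" "i \<preceq> i'" using \<open>i = i'\<close> by (simp_all add: le_def)
  have "entryM w' i cs" "length bs = length cs"
    using w'(3) \<open>i = i'\<close> While.prems(2,3) by simp_all
  with det While.prems(1) as w(1) w'(1) w(2) w'(2) ii w(3) show ?case by (rule seq_unique)
qed auto

lemma X_sem_iff:
  assumes xs: "distinct xs" "xs \<noteq> []" and "pvars S \<subseteq> set xs"
  shows "(v, v') \<in> X_sem M xs S \<longleftrightarrow>
    alphaM xs S (map v xs) (map v' xs) \<and> (\<forall>y. y \<notin> set xs \<longrightarrow> v' y = v y)"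
  using assms(3)
proof (induction S arbitrary: v v')
  case (Assign x e)
  have e: "val M (asg xs (map v xs)) e = val M v e"
    unfolding asg_def using Assign by (intro val_cong) (auto simp: upd_map)
  have "alphaM xs (Assign x e) (map v xs) (map v' xs) \<longleftrightarrow> (\<forall>y\<in>set xs. v' y = (v(x := val M v e)) y)"
    by (auto simp: e) (auto simp: asg_def upd_map)
  then show ?case using Assign by (auto simp: fun_eq_iff)
next
  case (Seq S1 S2)
  show ?case
  proof
    assume "(v, v') \<in> X_sem M xs (Seq S1 S2)"
    then obtain u where "(v, u) \<in> X_sem M xs S1" "(u, v') \<in> X_sem M xs S2" by auto
    then show "alphaM xs (Seq S1 S2) (map v xs) (map v' xs) \<and> (\<forall>y. y \<notin> set xs \<longrightarrow> v' y = v y)"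
      using Seq by (auto intro!: exI[of _ "map u xs"])
  next
    assume *: "alphaM xs (Seq S1 S2) (map v xs) (map v' xs) \<and> (\<forall>y. y \<notin> set xs \<longrightarrow> v' y = v y)"
    then obtain cs where "length cs = length xs" "alphaM xs S1 (map v xs) cs" "alphaM xs S2 cs (map v' xs)"
      by auto
    then have "(v, upd v xs cs) \<in> X_sem M xs S1" "(upd v xs cs, v') \<in> X_sem M xs S2"
      using Seq xs * by auto
    then show "(v, v') \<in> X_sem M xs (Seq S1 S2)" by auto
  qed
next
  case (Cond b S1 S2)
  then show ?case using sat_asg_map[of "bfm b" xs v] by auto
next
  case (While b S)
  then have b: "fvars (bfm b) \<subseteq> set xs" and S: "pvars S \<subseteq> set xs" by simp_all
  let ?n = "length xs"
  let ?R = "alphaM xs S"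
  let ?B = "\<lambda>as. sat M (asg xs as) (bfm b)"
  let ?RB = "\<lambda>ps qs. ?B ps \<and> ?R ps qs"
  define y where "y = new_var (set xs)"
  define zs where "zs = new_vars ?n (insert y (set xs))"
  have y: "y \<notin> set xs" unfolding y_def by (intro new_var_fresh) simp
  have zs: "set zs \<inter> insert y (set xs) = {}" unfolding zs_def by (intro new_vars_fresh) simp
  have zs': "length zs = ?n" "distinct zs" by (simp_all add: zs_def)
  have phi: "sat M (upd v (y # zs) (j # as)) (phi_fm xs S xs y zs) \<longleftrightarrow> seqM ?n ?R j (map v xs) as"
    if as: "length as = ?n" for j as
  proof -
    let ?u = "upd v (y # zs) (j # as)"
    have "sat M ?u (phi_fm xs S xs y zs) \<longleftrightarrow> seqM ?n ?R (?u y) (map ?u xs) (map ?u zs)"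
      unfolding phi_fm_def using S xs by (intro sat_seq_fm sat_alpha_fm) auto
    moreover have "?u y = j" by simp
    moreover have "map ?u xs = map v xs"
      using y zs by (intro map_upd_disjoint) auto
    moreover have "map ?u zs = map (upd v zs as) zs"
      using zs by (auto intro!: map_cong)
    then have "map ?u zs = as" using zs' as by (simp only: map_upd)
    ultimately show ?thesis by (simp only:)
  qed
  have B: "sat M (upd v xs as) (bfm b) \<longleftrightarrow> ?B as" if "length as = ?n" for as v
    using b that by (rule sat_asg)
  have step: "(upd v xs as, upd v xs bs) \<in> X_sem M xs S \<longleftrightarrow> ?R as bs"
    if "length as = ?n" "length bs = ?n" for as bs
    using While.IH[OF S] that xs by simp
  have X: "(v, v') \<in> X_sem M xs (While b S) \<longleftrightarrow> (\<exists>i c.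
      (\<forall>j. j \<preceq> i \<longrightarrow> length (c j) = ?n \<and> seqM ?n ?R j (map v xs) (c j)) \<and> map v xs = c \<zero> \<and>
      (\<forall>j. j \<prec> i \<longrightarrow> ?B (c j) \<and> ?R (c j) (c (j \<oplus> \<one>))) \<and> v' = upd v xs (c i) \<and> \<not> ?B (c i))"
    (is "_ \<longleftrightarrow> (\<exists>i c. ?P i c)")
  proof -
    have "(v, v') \<in> X_sem M xs (While b S) \<longleftrightarrow> (\<exists>i c.
            (\<forall>j. j \<preceq> i \<longrightarrow>
               length (c j) = length xs \<and>
               sat M (upd v (y # zs) (j # c j)) (phi_fm xs S xs y zs)) \<and>
            map v xs = c \<zero> \<and>
            (\<forall>j. j \<prec> i \<longrightarrow>
               sat M (upd v xs (c j)) (bfm b) \<and>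
               (upd v xs (c j), upd v xs (c (j \<oplus> \<one>))) \<in> X_sem M xs S) \<and>
            v' = upd v xs (c i) \<and> \<not> sat M v' (bfm b))" (is "_ \<longleftrightarrow> (\<exists>i c. ?Q i c)")
      unfolding X_sem.simps Let_def y_def[symmetric] zs_def[symmetric] le_def by blast
    also have "\<dots> \<longleftrightarrow> (\<exists>i c. ?P i c)"
    proof (intro ex_cong1)
      fix i c
      show "?Q i c \<longleftrightarrow> ?P i c"
      \<comment> \<open>The equivalences \<open>phi\<close>, \<open>B\<close> and
        \<open>step\<close> are available for vectors of the right length, which both sides
        demand.\<close>
      proof (cases "\<forall>j. j \<preceq> i \<longrightarrow> length (c j) = ?n")
        case True
        have "length (c j) = ?n" "length (c (j \<oplus> \<one>)) = ?n" if "j \<prec> i" for j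
        proof -
          have "j \<preceq> i" "j \<oplus> \<one> \<preceq> i" using that Suc_le_iff by (auto simp: le_def)
          then show "length (c j) = ?n" "length (c (j \<oplus> \<one>)) = ?n" using True by blast+
        qed
        moreover have "length (c i) = ?n" using True by (simp add: le_def)
        ultimately show ?thesis using True by (auto simp: phi B step simp del: upd_Cons)
      qed blast
    qed
    finally show ?thesis .
  qed
  have det: "qs = qs'" if "length ps = ?n" "length qs = ?n" "length qs' = ?n" "?R ps qs" "?R ps qs'" for ps qs qs'
    using alphaM_fun[OF xs] that by blast
  have ne: "map v xs \<noteq> []" "length (map v xs) = ?n" using xs by simp_all
  show ?case
  proof
    assume "(v, v') \<in> X_sem M xs (While b S)"
    then obtain i c where
      c: "\<And>j. j \<preceq> i \<Longrightarrow> length (c j) = ?n" "\<And>j. j \<preceq> i \<Longrightarrow> seqM ?n ?R j (map v xs) (c j)"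
      and c0: "map v xs = c \<zero>"
      and cs: "\<And>j. j \<prec> i \<Longrightarrow> ?B (c j)" 
      and v': "v' = upd v xs (c i)" "\<not> ?B (c i)"
      unfolding X by blast
    have ii: "i \<preceq> i" by (simp add: le_def)
    \<comment> \<open>The code belonging to the last stage is to serve for the whole run.\<close>
    obtain w where w: "entryM w \<zero> (map v xs)" "runM ?n ?R w i" "entryM w i (c i)"
      using c(2)[OF ii] unfolding seqM_def by blast
    \<comment> \<open>Stage \<open>j\<close> comes with a code \<open>w'\<close> of its own. Both
      runs have the same start and the same deterministic step, so \<open>w\<close> also has the
      entry \<open>c j\<close> at \<open>j\<close>.\<close>
    have wc: "ps = c j" if j: "j \<preceq> i" and ps: "entryM w j ps" "length ps = ?n" for j ps
    proof -
      obtain w' where w': "entryM w' \<zero> (map v xs)" "runM ?n ?R w' j" "entryM w' j (c j)"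
        using c(2)[OF j] unfolding seqM_def by blast
      have "j \<preceq> j" "length ps = length (c j)" using ps(2) c(1)[OF j] by (simp_all add: le_def)
      with det ne(2,1) w(1) w'(1) w(2) w'(2) j show ?thesis
        using ps(1) w'(3) by (intro seq_unique[of ?n ?R "map v xs" w w' i j j ps "c j"])
    qed
    have "runM ?n ?RB w i" unfolding runM_def
    proof (intro allI impI)
      fix j assume j: "j \<prec> i"
      then obtain ps qs where pq: "length ps = ?n" "length qs = ?n" "entryM w j ps"
        "entryM w (j \<oplus> \<one>) qs" "?R ps qs" using w(2) unfolding runM_def by blast
      then have "ps = c j" using wc[of j ps] j by (simp add: le_def)
      then show "\<exists>ps qs. length ps = ?n \<and> length qs = ?n \<and> entryM w j ps \<and>
          entryM w (j \<oplus> \<one>) qs \<and> ?RB ps qs" using pq cs[OF j] by blast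
    qed
    moreover have "map v' xs = c i" using v' c(1)[OF ii] xs by simp
    ultimately show "alphaM xs (While b S) (map v xs) (map v' xs) \<and> (\<forall>y. y \<notin> set xs \<longrightarrow> v' y = v y)"
      using w v' by (auto simp: seqM_def)
  next
    assume *: "alphaM xs (While b S) (map v xs) (map v' xs) \<and> (\<forall>y. y \<notin> set xs \<longrightarrow> v' y = v y)"
    then obtain i w where w: "entryM w \<zero> (map v xs)" "runM ?n ?RB w i" "entryM w i (map v' xs)"
      and nB: "\<not> ?B (map v' xs)" by (auto simp: seqM_def)
    \<comment> \<open>Up to \<open>i\<close> an entry of the right length exists and is unique, so
      the choice is determined there; beyond \<open>i\<close> it may be arbitrary.\<close>
    define c where "c j = (SOME ps. length ps = ?n \<and> entryM w j ps)" for j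
    have ceq: "c j = ps" if "length ps = ?n" "entryM w j ps" for j ps
      unfolding c_def using that by (intro some_equality) (auto intro: entryM_fun)
    have c: "length (c j) = ?n \<and> entryM w j (c j)" if "j \<preceq> i" for j
    proof -
      have "\<exists>ps. length ps = ?n \<and> entryM w j ps"
        using that w(2,3) unfolding runM_def le_def by (metis length_map)
      then show ?thesis unfolding c_def by (rule someI_ex)
    qed
    have "seqM ?n ?R j (map v xs) (c j)" if "j \<preceq> i" for j
      unfolding seqM_def using w(1) c[OF that] runM_mono[OF w(2) _ that, of ?R] by blast
    moreover have "map v xs = c \<zero>" using ceq[of "map v xs"] w(1) by simp
    moreover have "?B (c j) \<and> ?R (c j) (c (j \<oplus> \<one>))" if j: "j \<prec> i" for j
    proof -
      obtain ps qs where "length ps = ?n" "length qs = ?n" "entryM w j ps"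
        "entryM w (j \<oplus> \<one>) qs" "?RB ps qs" using w(2) j unfolding runM_def by blast
      then show ?thesis using ceq by metis
    qed
    moreover have "c i = map v' xs" using ceq[of "map v' xs"] w(3) by simp
    moreover from this have "v' = upd v xs (c i)" using * by (auto simp: upd_map fun_eq_iff)
    ultimately show "(v, v') \<in> X_sem M xs (While b S)" unfolding X using c nB
      by (intro exI[of _ i] exI[of _ c]) simp
  qed
qed


section \<open>Prolonging runs and preserving invariants along them\<close>

lemma seqM_0: "seqM n R \<zero> as as"
proof -
  obtain w where "entryM w \<zero> as" using entryM_extend by blast
  then show ?thesis unfolding seqM_def runM_def by auto
qed

text \<open>The extended code keeps all entries up to index \<open>i\<close>. So a step at
  \<open>j < i\<close> survives together with its target at \<open>j + 1\<close>, and only the step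
  at \<open>i\<close> is new.\<close>

lemma seqM_Suc:
  assumes "seqM n R i as bs" "R bs cs" "length bs = n" "length cs = n"
  shows "seqM n R (i \<oplus> \<one>) as cs"
proof -
  obtain w where w: "entryM w \<zero> as" "runM n R w i" "entryM w i bs"
    using assms(1) unfolding seqM_def by blast
  obtain w' where w': "\<And>j ds. j \<prec> i \<oplus> \<one> \<Longrightarrow> entryM w j ds \<Longrightarrow> entryM w' j ds" "entryM w' (i \<oplus> \<one>) cs"
    using entryM_extend[of "i \<oplus> \<one>" w cs] by blast
  have "\<exists>ps qs. length ps = n \<and> length qs = n \<and> entryM w' j ps \<and> entryM w' (j \<oplus> \<one>) qs \<and> R ps qs"
    if j: "j \<prec> i \<oplus> \<one>" for j
  proof (cases "j = i")
    case True
    then have "entryM w' j bs" using w'(1)[OF j] w(3) by simp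
    then show ?thesis using True w'(2) assms by blast
  next
    case False
    then have ji: "j \<prec> i" using j by (simp add: less_Suc)
    then obtain ps qs where pq: "length ps = n" "length qs = n" "entryM w j ps" "entryM w (j \<oplus> \<one>) qs" "R ps qs"
      using w(2) unfolding runM_def by blast
    have "j \<oplus> \<one> \<prec> i \<oplus> \<one>" using ji by simp
    then show ?thesis using pq w'(1) j by blast
  qed
  then have "runM n R w' (i \<oplus> \<one>)" unfolding runM_def by blast
  moreover have "entryM w' \<zero> as" using w'(1)[OF zero_less_Suc w(1)] .
  ultimately show ?thesis using w'(2) unfolding seqM_def by blast
qed

text \<open>That the entry at stage \<open>j\<close> satisfies \<open>r\<close> is definable because
  \<open>r\<close> is a formula; the relation \<open>R\<close>, which need not be definable, enters
  only through \<open>inv\<close> in the induction step.\<close>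

lemma seqM_invariant:
  assumes xs: "distinct xs"
    and inv: "\<And>as bs. length as = length xs \<Longrightarrow> length bs = length xs \<Longrightarrow> R as bs \<Longrightarrow>
      sat M (upd v xs as) r \<Longrightarrow> sat M (upd v xs bs) r"
    and init: "length as = length xs" "sat M (upd v xs as) r"
    and seq: "seqM (length xs) R i as bs" "length bs = length xs"
  shows "sat M (upd v xs bs) r"
proof -
  let ?n = "length xs"
  obtain w where w: "entryM w \<zero> as" "runM ?n R w i" "entryM w i bs"
    using seq unfolding seqM_def by blast
  define C where "C j \<longleftrightarrow> (j \<preceq> i \<longrightarrow> (\<exists>ps. length ps = ?n \<and> entryM w j ps \<and> sat M (upd v xs ps) r))" for j
  \<comment> \<open>Three variables outside \<open>xs\<close> and \<open>r\<close> are to hold the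
    stage, the length and the code, so that the parameters of \<open>r\<close> keep their values
    under \<open>v\<close>.\<close>
  define z where "z = new_var (set xs \<union> fvars r)"
  have "z + k \<notin> set xs \<union> fvars r" for k unfolding z_def by (intro new_var_notin) simp
  from this[of 0] this[of 1] this[of 2]
  have z: "z \<notin> set xs" "Suc z \<notin> set xs" "Suc (Suc z) \<notin> set xs"
    "z \<notin> fvars r" "Suc z \<notin> fvars r" "Suc (Suc z) \<notin> fvars r" by simp_all
  have "C i"
  proof (rule definable_induct)
    let ?p = "Imp (Or (Less (Var z) (Var (Suc z))) (Eq (Var z) (Var (Suc z))))
        (Exs xs (And (entry_fm (Var (Suc (Suc z))) (Var z) xs) r))"
    show "sat M ((v(Suc z := i, Suc (Suc z) := w))(z := j)) ?p \<longleftrightarrow> C j" for j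
    proof -
      let ?u = "v(Suc z := i, Suc (Suc z) := w, z := j)"
      have r: "sat M (upd ?u xs ps) r \<longleftrightarrow> sat M (upd v xs ps) r" for ps
        using z by (simp add: upd_fun_upd sat_upd_fresh)
      have u: "upd ?u xs ps z = j" "upd ?u xs ps (Suc (Suc z)) = w" "?u z = j" "?u (Suc z) = i" for ps
        using z by simp_all
      have "sat M ?u (Exs xs (And (entry_fm (Var (Suc (Suc z))) (Var z) xs) r)) \<longleftrightarrow>
          (\<exists>ps. length ps = ?n \<and> entryM w j ps \<and> sat M (upd v xs ps) r)"
        unfolding sat_Exs[OF xs] sat_And sat_entry_fm r val.simps u using map_upd[OF xs, of _ ?u] by metis
      then show ?thesis
        unfolding C_def le_def sat.simps(1-4) val.simps connective_simps by (simp only: u)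
    qed
    show "C \<zero>" unfolding C_def using init w by blast
    show "C (j \<oplus> \<one>)" if C: "C j" for j
      unfolding C_def
    proof
      assume "j \<oplus> \<one> \<preceq> i"
      then have j: "j \<prec> i" "j \<preceq> i" using Suc_le_iff by (auto simp: le_def)
      obtain ps where ps: "length ps = ?n" "entryM w j ps" "sat M (upd v xs ps) r"
        using C j(2) unfolding C_def by blast
      obtain ps' qs where pq: "length ps' = ?n" "length qs = ?n" "entryM w j ps'"
        "entryM w (j \<oplus> \<one>) qs" "R ps' qs" using w(2) j(1) unfolding runM_def by blast
      have "ps' = ps" using entryM_fun[OF pq(3) ps(2)] pq ps by simp
      then show "\<exists>ps. length ps = ?n \<and> entryM w (j \<oplus> \<one>) ps \<and> sat M (upd v xs ps) r"
        using inv pq ps by blast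
    qed
  qed
  then obtain ps where "length ps = ?n" "entryM w i ps" "sat M (upd v xs ps) r"
    unfolding C_def le_def by blast
  then show ?thesis using entryM_fun[of w i ps bs] w(3) seq(2) by simp
qed

end

section \<open>Hoare logic\<close>

lemma provable_sound: "provable T p \<Longrightarrow> is_model M T \<Longrightarrow> sat M v p"
proof (induction arbitrary: v rule: provable.induct)
  case (Inst x p t)
  then show ?case by (simp add: sat_subst1)
next
  case (Distr x p q)
  then show ?case by (simp add: sat_upd_fresh)
qed (auto simp: is_model_def)

text \<open>The vector \<open>xs\<close> of the whole program stays fixed for subprograms, hence the
  inclusion for \<open>pvars S\<close>. Logical variables outside \<open>xs\<close> keep their
  values under \<open>v\<close> throughout.\<close>

lemma (in pa_model) HL_sound:
  assumes "HL T p S q" "is_model M T" "distinct xs" "pvars S \<subseteq> set xs"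
    and "sat M v p" "alphaM xs S (map v xs) bs" "length bs = length xs"
  shows "sat M (upd v xs bs) q"
  using assms(1,4-)
proof (induction arbitrary: v bs rule: HL.induct)
  case (Assign p x e)
  let ?f = "(asg xs (map v xs))(x := val M (asg xs (map v xs)) e)"
  have e: "val M (asg xs (map v xs)) e = val M v e"
    unfolding asg_def using Assign by (intro val_cong) (auto simp: upd_map)
  have upd: "upd v xs bs = v(x := val M v e)"
    using Assign by (auto simp: e upd_map fun_eq_iff) (auto simp: asg_def upd_map)
  show ?case unfolding upd using Assign.prems(2) by (simp only: sat_subst1)
next
  case (Seq p S1 r S2 q)
  then obtain cs where cs: "length cs = length xs" "alphaM xs S1 (map v xs) cs" "alphaM xs S2 cs bs"
    by auto
  then have "sat M (upd v xs cs) r" using Seq by auto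
  moreover have "alphaM xs S2 (map (upd v xs cs) xs) bs" using cs assms(3) by simp
  ultimately have "sat M (upd (upd v xs cs) xs bs) q" using Seq by auto
  then show ?case using Seq.prems by (simp add: upd_upd)
next
  case (Cond p b S1 q S2)
  have "sat M (asg xs (map v xs)) (bfm b) \<longleftrightarrow> sat M v (bfm b)"
    using Cond by (intro sat_asg_map) simp
  then show ?case using Cond by (cases "sat M v (bfm b)") auto
next
  case (While r b S)
  have b: "fvars (bfm b) \<subseteq> set xs" using While by simp
  obtain i where i: "seqM (length xs) (\<lambda>ps qs. sat M (asg xs ps) (bfm b) \<and> alphaM xs S ps qs) i (map v xs) bs"
    and nb: "\<not> sat M (asg xs bs) (bfm b)" using While.prems by auto
  have "sat M (upd v xs bs) r"
  proof (rule seqM_invariant[OF assms(3) _ _ _ i])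
    show "sat M (upd v xs (map v xs)) r" using While.prems by (simp add: upd_map cong: sat_cong)
    fix as cs assume *: "length as = length xs" "length cs = length xs"
      "sat M (asg xs as) (bfm b) \<and> alphaM xs S as cs" "sat M (upd v xs as) r"
    then have "sat M (upd (upd v xs as) xs cs) r"
      using While assms(3) sat_asg[OF b *(1), of v] by auto
    then show "sat M (upd v xs cs) r" using * by (simp add: upd_upd)
  qed (use While.prems in auto)
  then show ?case using nb sat_asg[OF b, of bs v] While.prems by simp
next
  case (Conseq p p1 S q1 q)
  have "sat M v p1" using provable_sound[OF Conseq.hyps(1) assms(2), of v] Conseq.prems by simp
  then have "sat M (upd v xs bs) q1" using Conseq by blast
  then show ?case using provable_sound[OF Conseq.hyps(3) assms(2), of "upd v xs bs"] by simp
qed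

text \<open>The strongest postcondition of \<open>p\<close> under a relation: the bound
  \<open>us\<close> remember the initial values while \<open>xs\<close> hold the current ones. The
  relation is passed as a function because \<open>us\<close> is chosen here, fresh for
  \<open>p\<close>.\<close>

definition sp_fm :: "nat list \<Rightarrow> (nat list \<Rightarrow> fm) \<Rightarrow> fm \<Rightarrow> fm" where
  "sp_fm xs rel p = (let us = new_vars (length xs) (set xs \<union> fvars p)
     in Exs us (And (subst p (at_vars xs us)) (rel us)))"

lemma sat_sp_fm:
  assumes xs: "distinct xs"
    and rel: "\<And>u us. length us = length xs \<Longrightarrow> set us \<inter> set xs = {} \<Longrightarrow>
      sat M u (rel us) \<longleftrightarrow> R (map u us) (map u xs)"
  shows "sat M v (sp_fm xs rel p) \<longleftrightarrow>
    (\<exists>as. length as = length xs \<and> sat M (upd v xs as) p \<and> R as (map v xs))"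
proof -
  define us where "us = new_vars (length xs) (set xs \<union> fvars p)"
  have us: "length us = length xs" "distinct us" "set us \<inter> (set xs \<union> fvars p) = {}"
    unfolding us_def by (simp, simp, intro new_vars_fresh) simp
  have "sat M (upd v us as) (And (subst p (at_vars xs us)) (rel us)) \<longleftrightarrow>
      sat M (upd v xs as) p \<and> R as (map v xs)" if as: "length as = length xs" for as
  proof -
    have "sat M (upd v us as) (subst p (at_vars xs us)) \<longleftrightarrow> sat M (upd (upd v us as) xs as) p"
      using us as by (simp add: sat_at_vars)
    also have "\<dots> \<longleftrightarrow> sat M (upd v xs as) p"
    proof (rule sat_cong)
      fix x assume "x \<in> fvars p"
      then have "x \<notin> set us" using us by auto
      then show "upd (upd v us as) xs as x = upd v xs as x"
        using as by (cases "x \<in> set xs") (auto intro: upd_in_cong)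
    qed
    finally have "sat M (upd v us as) (subst p (at_vars xs us)) \<longleftrightarrow> sat M (upd v xs as) p" .
    moreover have "map (upd v us as) xs = map v xs" using us by (intro map_upd_disjoint) auto
    moreover have "map (upd v us as) us = as" using us as by simp
    moreover have "sat M (upd v us as) (rel us) \<longleftrightarrow> R (map (upd v us as) us) (map (upd v us as) xs)"
      using us by (intro rel) auto
    ultimately show ?thesis by (simp only: sat_And)
  qed
  then show ?thesis
    unfolding sp_fm_def Let_def us_def[symmetric] sat_Exs[OF us(2)] us(1) by blast
qed

text \<open>Relative completeness: the intermediate assertions are strongest postconditions, and a loop
  invariant is the strongest postcondition of an arbitrary number of iterations. The premises of the
  consequence rule are valid, hence provable by the completeness theorem.\<close>

lemma HL_complete:
  assumes T: "PA \<subseteq> T" and xs: "distinct xs" and "pvars S \<subseteq> set xs"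
    and valid: "\<And>(M :: nat interp) v bs. is_model M T \<Longrightarrow> sat M v p \<Longrightarrow> length bs = length xs \<Longrightarrow>
      pa_model.alphaM M xs S (map v xs) bs \<Longrightarrow> sat M (upd v xs bs) q"
  shows "HL T p S q"
  using assms(3-)
proof (induction S arbitrary: p q)
  have pa: "pa_model M" if "is_model M T" for M :: "nat interp"
    using that T by (auto simp: pa_model_def is_model_def)
  have self: "upd v xs (map v xs) = v" for v :: "nat \<Rightarrow> nat" by (rule ext) (simp add: upd_map)
  \<comment> \<open>Completeness replaces the provability premises of the consequence rule by
    validity over \<open>nat\<close>.\<close>
  have weaken: "HL T p S q" if "HL T p' S q'" "\<And>(M :: nat interp) v. is_model M T \<Longrightarrow> sat M v p \<Longrightarrow> sat M v p'"
    "\<And>(M :: nat interp) v. is_model M T \<Longrightarrow> sat M v q' \<Longrightarrow> sat M v q" for p p' q q' S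
    using that by (intro HL.Conseq[of T p p' S q' q] completeness[OF T]) auto
  {
    case (Assign x e)
    show ?case
    proof (rule weaken[OF HL.Assign])
      fix M :: "nat interp" and v assume M: "is_model M T" "sat M v p"
      interpret pa_model M by (rule pa[OF M(1)])
      let ?v = "v(x := val M v e)"
      have e: "val M (asg xs (map v xs)) e = val M v e"
        unfolding asg_def using Assign by (intro val_cong) (auto simp: upd_map)
      have "alphaM xs (Assign x e) (map v xs) (map ?v xs)"
        by (auto simp: e) (auto simp: asg_def upd_map)
      then have "sat M (upd v xs (map ?v xs)) q" using M Assign by (intro Assign.prems) auto
      moreover have "upd v xs (map ?v xs) = ?v" using Assign by (auto simp: upd_map fun_eq_iff)
      ultimately show "sat M v (subst1 q x e)" by (simp add: sat_subst1)
    qed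
  next
    case (Seq S1 S2)
    define r where "r = sp_fm xs (\<lambda>us. alpha_fm xs S1 us xs) p"
    have r: "sat M v r \<longleftrightarrow> (\<exists>as. length as = length xs \<and> sat M (upd v xs as) p \<and>
        pa_model.alphaM M xs S1 as (map v xs))" if "is_model M T" for M :: "nat interp" and v
      unfolding r_def using Seq.prems(1) xs
      by (intro sat_sp_fm pa_model.sat_alpha_fm[OF pa[OF that]]) auto
    show ?case
    proof (rule HL.Seq)
      show "HL T p S1 r"
      proof (rule Seq.IH(1))
        fix M :: "nat interp" and v bs
        assume *: "is_model M T" "sat M v p" "length bs = length xs" "pa_model.alphaM M xs S1 (map v xs) bs"
        then show "sat M (upd v xs bs) r" using xs
          by (auto simp: r upd_upd self intro!: exI[of _ "map v xs"])
      qed (use Seq.prems in auto)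
      show "HL T r S2 q"
      proof (rule Seq.IH(2))
        fix M :: "nat interp" and v bs
        assume *: "is_model M T" "sat M v r" "length bs = length xs" "pa_model.alphaM M xs S2 (map v xs) bs"
        interpret pa_model M by (rule pa[OF *(1)])
        obtain as where as: "length as = length xs" "sat M (upd v xs as) p" "alphaM xs S1 as (map v xs)"
          using * r by blast
        have "alphaM xs (Seq S1 S2) (map (upd v xs as) xs) bs"
          using as * xs by (auto intro!: exI[of _ "map v xs"])
        then have "sat M (upd (upd v xs as) xs bs) q" using * as by (intro Seq.prems) auto
        then show "sat M (upd v xs bs) q" using * by (simp add: upd_upd)
      qed (use Seq.prems in auto)
    qed
  next
    case (Cond b S1 S2)
    then have b: "fvars (bfm b) \<subseteq> set xs" by simp
    show ?case
    proof (rule HL.Cond)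
      show "HL T (And p (bfm b)) S1 q"
      proof (rule Cond.IH(1))
        fix M :: "nat interp" and v bs
        assume *: "is_model M T" "sat M v (And p (bfm b))" "length bs = length xs" "pa_model.alphaM M xs S1 (map v xs) bs"
        interpret pa_model M by (rule pa[OF *(1)])
        show "sat M (upd v xs bs) q"
          using * sat_asg_map[OF b, of v] by (intro Cond.prems(2)) auto
      qed (use Cond.prems in auto)
      show "HL T (And p (Neg (bfm b))) S2 q"
      proof (rule Cond.IH(2))
        fix M :: "nat interp" and v bs
        assume *: "is_model M T" "sat M v (And p (Neg (bfm b)))" "length bs = length xs" "pa_model.alphaM M xs S2 (map v xs) bs"
        interpret pa_model M by (rule pa[OF *(1)])
        show "sat M (upd v xs bs) q"
          using * sat_asg_map[OF b, of v] by (intro Cond.prems(2)) auto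
      qed (use Cond.prems in auto)
    qed
  next
    case (While b S)
    then have b: "fvars (bfm b) \<subseteq> set xs" and S: "pvars S \<subseteq> set xs" by simp_all
    let ?step = "\<lambda>ps qs. And (subst (bfm b) (at_vars xs ps)) (alpha_fm xs S ps qs)"
    let ?R = "\<lambda>M ps qs. sat M (pa_model.asg M xs ps) (bfm b) \<and> pa_model.alphaM M xs S ps qs"
    let ?n = "length xs"
    \<comment> \<open>The number \<open>i\<close> of iterations is quantified inside the formula, so
      in a nonstandard model the invariant also covers nonstandard numbers of iterations.\<close>
    define r where "r = sp_fm xs (\<lambda>us. let i = new_var (set us \<union> set xs) in Exists i (seq_fm ?step i us xs)) p"
    have r: "sat M v r \<longleftrightarrow> (\<exists>as. length as = ?n \<and> sat M (upd v xs as) p \<and>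
        (\<exists>i. pa_model.seqM M ?n (?R M) i as (map v xs)))" if M: "is_model M T" for M :: "nat interp" and v
      unfolding r_def
    proof (rule sat_sp_fm[OF xs])
      interpret pa_model M by (rule pa[OF M])
      fix u :: "nat \<Rightarrow> nat" and us :: "nat list" assume us: "length us = ?n"
      define i where "i = new_var (set us \<union> set xs)"
      have i: "i \<notin> set us \<union> set xs" unfolding i_def by (intro new_var_fresh) simp
      then have *: "map (u(i := a)) us = map u us" "map (u(i := a)) xs = map u xs" for a by auto
      have "sat M w (seq_fm ?step i us xs) \<longleftrightarrow> seqM ?n (?R M) (w i) (map w us) (map w xs)" for w
        unfolding us[symmetric] using us S b xs
        by (intro sat_seq_fm) (simp add: sat_bfm_at sat_alpha_fm)
      then show "sat M u (let i = new_var (set us \<union> set xs) in Exists i (seq_fm ?step i us xs)) \<longleftrightarrow>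
          (\<exists>i. seqM ?n (?R M) i (map u us) (map u xs))"
        unfolding Let_def i_def[symmetric] sat_Exists by (simp add: *)
    qed
    have "HL T (And r (bfm b)) S r"
    proof (rule While.IH)
      fix M :: "nat interp" and v bs
      assume *: "is_model M T" "sat M v (And r (bfm b))" "length bs = ?n" "pa_model.alphaM M xs S (map v xs) bs"
      interpret pa_model M by (rule pa[OF *(1)])
      obtain as i where as: "length as = ?n" "sat M (upd v xs as) p" "seqM ?n (?R M) i as (map v xs)"
        using *(1,2) r by (auto simp: sat_And)
      have "?R M (map v xs) bs" using *(2,4) sat_asg_map[OF b, of v] by simp
      then have "seqM ?n (?R M) (iplus M i (ione M)) as bs"
        using *(3) by (intro seqM_Suc[OF as(3)]) simp_all
      then show "sat M (upd v xs bs) r"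
        unfolding r[OF *(1)] using as * xs by (auto simp: upd_upd)
    qed (use While.prems in auto)
    then show ?case
    proof (intro weaken[OF HL.While])
      fix M :: "nat interp" and v
      assume *: "is_model M T" "sat M v p"
      interpret pa_model M by (rule pa[OF *(1)])
      have "seqM ?n (?R M) (izero M) (map v xs) (map v xs)" by (rule seqM_0)
      then show "sat M v r" unfolding r[OF *(1)] using *(2)
        by (intro exI[of _ "map v xs"]) (auto simp: self)
    next
      fix M :: "nat interp" and v
      assume *: "is_model M T" "sat M v (And r (Neg (bfm b)))"
      interpret pa_model M by (rule pa[OF *(1)])
      obtain as i where as: "length as = ?n" "sat M (upd v xs as) p" "seqM ?n (?R M) i as (map v xs)"
        using * r by (auto simp: sat_And)
      \<comment> \<open>Once the test fails, the iterations recorded by the invariant form a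
        complete run from a state satisfying \<open>p\<close>.\<close>
      have "alphaM xs (While b S) (map (upd v xs as) xs) (map v xs)"
        using as xs *(2) sat_asg_map[OF b, of v] by auto
      then have "sat M (upd (upd v xs as) xs (map v xs)) q"
        using * as by (intro While.prems) auto
      then show "sat M v q" by (simp add: upd_upd self)
    qed
  }
qed

text \<open>It ensures that tuples of program values are nonempty, hence have unique codes, as
  determinism of coded runs requires.\<close>

lemma pvars_nonempty: "pvars S \<noteq> {}"
  by (induction S) auto

theorem theorem6p1p2:
  fixes T :: "fm set" and M :: "'a interp" and S :: prog and xs :: "nat list"
  assumes "PA \<subseteq> T" and "T \<subseteq> Th_N"
    and "countable (UNIV :: 'a set)" and "is_model M T"
    and "distinct xs" and "set xs = pvars S"
  shows "AX T M xs S = X_sem M xs S"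
proof -
  interpret pa_model M
    using assms(1,4) by (auto simp: pa_model_def is_model_def)
  have ne: "xs \<noteq> []" using pvars_nonempty[of S] assms(6) by auto
  have iff: "(\<sigma>, \<tau>) \<in> X_sem M xs S \<longleftrightarrow>
      alphaM xs S (map \<sigma> xs) (map \<tau> xs) \<and> (\<forall>y. y \<notin> set xs \<longrightarrow> \<tau> y = \<sigma> y)" for \<sigma> \<tau>
    using assms ne by (intro X_sem_iff) auto
  have "(\<sigma>, \<tau>) \<in> AX T M xs S \<longleftrightarrow> (\<sigma>, \<tau>) \<in> X_sem M xs S" for \<sigma> \<tau>
  proof
    assume AX: "(\<sigma>, \<tau>) \<in> AX T M xs S"
    define us where "us = new_vars (length xs) (set xs)"
    have us: "length us = length xs" "distinct us" "set us \<inter> set xs = {}"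
      unfolding us_def by (simp, simp, intro new_vars_fresh) simp
    define p where "p = foldr And (map (\<lambda>(x, u). Eq (Var x) (Var u)) (zip xs us)) (Eq Zero Zero)"
    \<comment> \<open>The domain is kept polymorphic: \<open>p\<close> is evaluated in models over
      \<open>nat\<close> and in \<open>M\<close>.\<close>
    have p: "sat N v p \<longleftrightarrow> map v xs = map v us" for N :: "'b interp" and v
      using us(1) unfolding p_def sat_foldr_And by (induction us xs rule: list_induct2) auto
    have "HL T p S (alpha_fm xs S us xs)"
    proof (rule HL_complete[OF assms(1,5)])
      fix N :: "nat interp" and v bs
      assume *: "is_model N T" "sat N v p" "length bs = length xs" "pa_model.alphaM N xs S (map v xs) bs"
      interpret N: pa_model N using *(1) assms(1) by (auto simp: pa_model_def is_model_def)
      have "map (upd v xs bs) us = map v us" using us(3) by (intro map_upd_disjoint) auto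
      then have "map (upd v xs bs) us = map v xs" using p *(2) by metis
      then have "N.alphaM xs S (map (upd v xs bs) us) (map (upd v xs bs) xs)"
        using *(4) map_upd[OF assms(5) *(3)] by (simp only:)
      then show "sat N (upd v xs bs) (alpha_fm xs S us xs)"
        using assms(5,6) us(1) by (subst N.sat_alpha_fm) auto
    qed (use assms in auto)
    then have imp: "sat M (upd v xs (map \<sigma> xs)) p \<Longrightarrow> sat M (upd v xs (map \<tau> xs)) (alpha_fm xs S us xs)" for v
      using AX unfolding AX_def by blast
    \<comment> \<open>\<open>AX\<close> allows any assignment outside \<open>xs\<close>; this one
      stores the initial values in \<open>us\<close>, where the program cannot change them.\<close>
    let ?v = "upd \<sigma> us (map \<sigma> xs)"
    have u: "map (upd ?v xs cs) us = map \<sigma> xs" for cs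
    proof -
      have "map (upd ?v xs cs) us = map ?v us" using us(3) by (intro map_upd_disjoint) auto
      then show ?thesis using us by simp
    qed
    have "sat M (upd ?v xs (map \<sigma> xs)) p" unfolding p u using assms(5) by simp
    then have "sat M (upd ?v xs (map \<tau> xs)) (alpha_fm xs S us xs)" by (rule imp)
    then have "alphaM xs S (map \<sigma> xs) (map \<tau> xs)"
      using assms us u[of "map \<tau> xs"] by (simp add: sat_alpha_fm)
    then show "(\<sigma>, \<tau>) \<in> X_sem M xs S" using AX by (auto simp: iff AX_def)
  next
    assume X: "(\<sigma>, \<tau>) \<in> X_sem M xs S"
    show "(\<sigma>, \<tau>) \<in> AX T M xs S"
      unfolding AX_def
    proof (intro CollectI case_prodI conjI allI impI)
      fix p q v
      assume *: "HL T p S q" "sat M (upd v xs (map \<sigma> xs)) p"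
      have "alphaM xs S (map (upd v xs (map \<sigma> xs)) xs) (map \<tau> xs)"
        using X assms(5) by (simp add: iff)
      then have "sat M (upd (upd v xs (map \<sigma> xs)) xs (map \<tau> xs)) q"
        using assms(6) by (intro HL_sound[OF *(1) assms(4,5) _ *(2)]) auto
      then show "sat M (upd v xs (map \<tau> xs)) q" by (simp add: upd_upd)
    qed (use X iff in auto)
  qed
  then show ?thesis by auto
qed

end
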